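(* Let $\mu>0$, $\lambda>0$, $h=-\frac{3}{20}\lambda$ and $V_0=\frac{3\mu^4}{\lambda}$. For $Q\in\mathfrak h_0(5)$ define $$V_A(Q):=\begin{cases} \displaystyle V\left(\frac{\delta}{d_A}\Phi_A^-+\left(1-\frac{\delta}{d_A}\right)\Phi_A^+\right), & d(Q,\Sigma_A^+)=\delta<d_A/2,\\[6pt] \displaystyle V\left(\frac{\delta}{d_A}\Phi_A^++\left(1-\frac{\delta}{d_A}\right)\Phi_A^-\right), & d(Q,\Sigma_A^-)=\delta<d_A/2,\\[6pt] 0, & d(Q,\Sigma_A^+)\ge d_A/2\text{ and }d(Q,\Sigma_A^-)\ge d_A/2 . \end{cases}$$ Then $V(Q)\ge V_A(Q)$ for every $Q\in\mathfrak h_0(5)$.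
   Context: Let $\mathfrak h_0(5)=\{Q\in\mathbb C^{5\times5}:Q^\dagger=Q,\ \operatorname{Tr}Q=0\}$ with norm $\lVert A\rVert_F=(\operatorname{Tr}(A^2))^{1/2}$. The potential is $$V(\Phi)=-\mu^2\operatorname{Tr}(\Phi^2)+h\bigl(\operatorname{Tr}(\Phi^2)\bigr)^2+\lambda\operatorname{Tr}(\Phi^4)+V_0,\qquad\Phi\in\mathfrak h_0(5).$$ Set $u=\frac{\sqrt5\,\mu}{5\sqrt\lambda}$, $\Phi_A^+=u\operatorname{diag}(3,3,-2,-2,-2)$, $\Phi_A^-=u\operatorname{diag}(2,2,-3,-3,2)$, and $\Sigma_A^\pm=\{U^\dagger\Phi_A^\pm U:U\in\operatorname{SU}(5)\}$. For a nonempty compact $S\subset\mathfrak h_0(5)$, $d(Q,S)=\min_{P\in S}\lVert Q-P\rVert_F$, and $d_A=\min\{\lVert P-Q\rVert_F:P\in\Sigma_A^-,\,Q\in\Sigma_A^+\}=2\sqrt5\,u$; the first two cases in the definition of $V_A$ cannot overlap because of the triangle inequality. *)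

theory Defs
  imports "HOL-Analysis.Analysis"
begin

definition dagger :: "complex^'n^'m \<Rightarrow> complex^'m^'n" where
  "dagger A = map_matrix cnj (transpose A)"

definition special_unitary :: "(complex^'n^'n) set" where
  "special_unitary = {U. dagger U ** U = mat 1 \<and> U ** dagger U = mat 1 \<and> det U = 1}"

definition hermitian_traceless :: "(complex^'n^'n) set" where
  "hermitian_traceless = {Q. dagger Q = Q \<and> trace Q = 0}"

definition diag_mat :: "real^'n \<Rightarrow> complex^'n^'n" where
  "diag_mat a = (\<chi> i j. if i = j then of_real (a $ i) else 0)"

text \<open>The trace of a power of a Hermitian matrix is real, so \<^const>\<open>Re\<close> below only
  changes the type. Products are written with \<open>**\<close>, since \<open>*\<close> and \<open>^\<close> are not the
  matrix operations on this type.\<close>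

definition frob :: "complex^'n^'n \<Rightarrow> real" where
  "frob A = sqrt (Re (trace (A ** A)))"

definition potential :: "real \<Rightarrow> real \<Rightarrow> real \<Rightarrow> real \<Rightarrow> complex^'n^'n \<Rightarrow> real" where
  "potential \<mu> h lam V\<^sub>0 \<Phi> =
     - \<mu>\<^sup>2 * Re (trace (\<Phi> ** \<Phi>)) + h * (Re (trace (\<Phi> ** \<Phi>)))\<^sup>2
     + lam * Re (trace (\<Phi> ** \<Phi> ** \<Phi> ** \<Phi>)) + V\<^sub>0"

definition vac_scale :: "real \<Rightarrow> real \<Rightarrow> real" where
  "vac_scale \<mu> lam = sqrt 5 * \<mu> / (5 * sqrt lam)"

definition vac_plus :: "real \<Rightarrow> real \<Rightarrow> complex^5^5" where
  "vac_plus \<mu> lam = vac_scale \<mu> lam *\<^sub>R diag_mat (vector [3, 3, -2, -2, -2])"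

definition vac_minus :: "real \<Rightarrow> real \<Rightarrow> complex^5^5" where
  "vac_minus \<mu> lam = vac_scale \<mu> lam *\<^sub>R diag_mat (vector [2, 2, -3, -3, 2])"

definition orbit :: "complex^'n^'n \<Rightarrow> (complex^'n^'n) set" where
  "orbit P = {dagger U ** P ** U | U. U \<in> special_unitary}"

text \<open>On compact sets of Hermitian matrices these infima are minima; see
  \<open>frob_dist_attained\<close> and \<open>frob_setdist_attained\<close> below.\<close>

definition frob_dist :: "complex^'n^'n \<Rightarrow> (complex^'n^'n) set \<Rightarrow> real" where
  "frob_dist Q S = (INF P\<in>S. frob (Q - P))"

definition frob_setdist :: "(complex^'n^'n) set \<Rightarrow> (complex^'n^'n) set \<Rightarrow> real" where
  "frob_setdist S T = (INF (P, Q)\<in>S \<times> T. frob (P - Q))"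

definition vac_dist :: "real \<Rightarrow> real \<Rightarrow> real" where
  "vac_dist \<mu> lam = frob_setdist (orbit (vac_minus \<mu> lam)) (orbit (vac_plus \<mu> lam))"

text \<open>The first two cases exclude each other by the triangle inequality, so their order
  is immaterial.\<close>

definition lower_potential :: "real \<Rightarrow> real \<Rightarrow> real \<Rightarrow> real \<Rightarrow> complex^5^5 \<Rightarrow> real" where
  "lower_potential \<mu> h lam V\<^sub>0 Q =
     (let d = vac_dist \<mu> lam;
          p = vac_plus \<mu> lam;
          m = vac_minus \<mu> lam;
          \<delta>\<^sub>p = frob_dist Q (orbit p);
          \<delta>\<^sub>m = frob_dist Q (orbit m)
      in if \<delta>\<^sub>p < d / 2 then potential \<mu> h lam V\<^sub>0 ((\<delta>\<^sub>p / d) *\<^sub>R m + (1 - \<delta>\<^sub>p / d) *\<^sub>R p)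
         else if \<delta>\<^sub>m < d / 2 then potential \<mu> h lam V\<^sub>0 ((\<delta>\<^sub>m / d) *\<^sub>R p + (1 - \<delta>\<^sub>m / d) *\<^sub>R m)
         else 0)"

lemma dagger_nth [simp]: "dagger A $ i $ j = cnj (A $ j $ i)"
  by (simp add: dagger_def transpose_def map_matrix_def)

lemma dagger_mult: "dagger (A ** B) = dagger B ** dagger A"
  by (simp add: vec_eq_iff matrix_matrix_mult_def mult.commute)

lemma dagger_dagger [simp]: "dagger (dagger A) = A"
  by (simp add: vec_eq_iff)

lemma dagger_diff: "dagger (A - B) = dagger A - dagger B"
  by (simp add: vec_eq_iff)

lemma dagger_vac: "dagger (vac_plus \<mu> lam) = vac_plus \<mu> lam" "dagger (vac_minus \<mu> lam) = vac_minus \<mu> lam"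
  by (auto simp: vec_eq_iff vac_plus_def vac_minus_def diag_mat_def)

lemma norm_matrix_power2:
  fixes A :: "complex^'n^'m"
  shows "(norm A)\<^sup>2 = (\<Sum>i\<in>UNIV. \<Sum>j\<in>UNIV. (cmod (A $ i $ j))\<^sup>2)"
  by (simp add: norm_vec_def L2_set_def sum_nonneg)

lemma trace_dagger_mult: "Re (trace (A ** dagger A)) = (norm A)\<^sup>2"
  unfolding norm_matrix_power2
  by (simp add: trace_def matrix_matrix_mult_def flip: complex_norm_square)

lemma frob_eq_norm: "dagger A = A \<Longrightarrow> frob A = norm A"
  unfolding frob_def using trace_dagger_mult[of A] by simp

lemma continuous_on_dagger [continuous_intros]:
  "continuous_on S f \<Longrightarrow> continuous_on S (\<lambda>x. dagger (f x))"
  unfolding dagger_def map_matrix_def transpose_def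
  by (intro continuous_intros) auto

lemma continuous_on_matrix_mult:
  fixes f :: "'a::topological_space \<Rightarrow> complex^'n^'m" and g :: "'a \<Rightarrow> complex^'k^'n"
  shows "continuous_on S f \<Longrightarrow> continuous_on S g \<Longrightarrow> continuous_on S (\<lambda>x. f x ** g x)"
  unfolding matrix_matrix_mult_def by (intro continuous_intros) auto

lemma compact_special_unitary: "compact (special_unitary :: (complex^'n^'n) set)"
proof -
  have "closed (special_unitary :: (complex^'n^'n) set)"
    unfolding special_unitary_def det_def
    by (intro closed_Collect_conj closed_Collect_eq continuous_on_matrix_mult continuous_intros)
  moreover have "bounded (special_unitary :: (complex^'n^'n) set)"
  proof (rule boundedI)
    fix U :: "complex^'n^'n" assume "U \<in> special_unitary"
    then have "(norm U)\<^sup>2 = Re (trace (mat 1 :: complex^'n^'n))"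
      using trace_dagger_mult[of U] by (simp add: special_unitary_def)
    then show "norm U \<le> sqrt (Re (trace (mat 1 :: complex^'n^'n)))"
      by (metis norm_ge_zero order_refl real_sqrt_abs abs_of_nonneg)
  qed
  ultimately show ?thesis
    by (simp add: compact_eq_bounded_closed)
qed

lemma compact_orbit: "compact (orbit P)"
proof -
  have "orbit P = (\<lambda>U. dagger U ** P ** U) ` special_unitary"
    by (auto simp: orbit_def)
  then show ?thesis
    by (auto intro!: compact_continuous_image continuous_on_matrix_mult continuous_intros
        compact_special_unitary)
qed

lemma orbit_nonempty:
  fixes P :: "complex^'n^'n"
  shows "orbit P \<noteq> {}"
proof -
  have "dagger (mat 1 :: complex^'n^'n) = mat 1"
    by (auto simp: vec_eq_iff mat_def)
  then have "(mat 1 :: complex^'n^'n) \<in> special_unitary"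
    by (simp add: special_unitary_def)
  then show ?thesis
    by (auto simp: orbit_def)
qed

lemma orbit_hermitian: "dagger P = P \<Longrightarrow> Q \<in> orbit P \<Longrightarrow> dagger Q = Q"
  by (auto simp: orbit_def dagger_mult matrix_mul_assoc)

lemma frob_dist_attained:
  assumes "compact S" "S \<noteq> {}" "dagger Q = Q" "\<And>P. P \<in> S \<Longrightarrow> dagger P = P"
  shows "\<exists>P\<in>S. frob_dist Q S = frob (Q - P) \<and> (\<forall>P'\<in>S. frob (Q - P) \<le> frob (Q - P'))"
proof -
  have *: "frob (Q - P) = norm (Q - P)" if "P \<in> S" for P
    using assms that by (simp add: frob_eq_norm dagger_diff)
  have "continuous_on S (\<lambda>P. norm (Q - P))"
    by (intro continuous_intros)
  then obtain P where P: "P \<in> S" "\<And>P'. P' \<in> S \<Longrightarrow> norm (Q - P) \<le> norm (Q - P')"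
    using continuous_attains_inf[OF assms(1,2)] by blast
  then have "frob_dist Q S = frob (Q - P)"
    unfolding frob_dist_def by (intro cInf_eq_minimum) (auto simp: *)
  then show ?thesis
    using P * by auto
qed

lemma frob_setdist_attained:
  assumes "compact S" "S \<noteq> {}" "compact T" "T \<noteq> {}"
    "\<And>P. P \<in> S \<union> T \<Longrightarrow> dagger P = P"
  shows "\<exists>P\<in>S. \<exists>Q\<in>T. frob_setdist S T = frob (P - Q) \<and>
    (\<forall>P'\<in>S. \<forall>Q'\<in>T. frob (P - Q) \<le> frob (P' - Q'))"
proof -
  have *: "frob (P - Q) = norm (P - Q)" if "P \<in> S" "Q \<in> T" for P Q
    using assms(5) that by (simp add: frob_eq_norm dagger_diff)
  have "continuous_on (S \<times> T) (\<lambda>x. norm (fst x - snd x))"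
    by (intro continuous_intros)
  moreover have "compact (S \<times> T)" "S \<times> T \<noteq> {}"
    using assms by (auto simp: compact_Times)
  ultimately obtain P Q where P: "P \<in> S" "Q \<in> T" "\<And>P' Q'. P' \<in> S \<Longrightarrow> Q' \<in> T \<Longrightarrow> norm (P - Q) \<le> norm (P' - Q')"
    using continuous_attains_inf[of "S \<times> T" "\<lambda>x. norm (fst x - snd x)"] by auto
  then have "frob_setdist S T = frob (P - Q)"
    unfolding frob_setdist_def by (intro cInf_eq_minimum) (force simp: *)+
  then show ?thesis
    using P * by auto
qed

lemma vector_5:
  fixes a b c d e :: real
  defines "v \<equiv> vector [a, b, c, d, e] :: real^5"
  shows "v $ 1 = a" "v $ 2 = b" "v $ 3 = c" "v $ 4 = d" "v $ 5 = e"
  by (simp_all add: v_def vector_def)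

end

theory Submission
  imports Defs
begin

text \<open>Both sides are invariant under unitary conjugation, so \<open>Q\<close> may be taken diagonal. In units of
  the vacuum scale \<open>u\<close> the potential of the eigenvalues \<open>x\<close> is
  \<open>lam u\<^sup>4 W\<close> with \<open>W = 75 - 5 t - 3/20 t\<^sup>2 + q\<close>, where \<open>t\<close> and \<open>q\<close> are the sums of the squares and
  of the fourth powers, and along the segment between the two vacua \<open>W = 200 s\<^sup>2 (1 - s)\<^sup>2\<close>. The squared
  distance to an orbit is linear in \<open>t\<close> and in the sum of the two top (or bottom) eigenvalues, by the
  rearrangement inequality for the doubly stochastic matrix of squared moduli of a unitary matrix.
  What remains is a quartic inequality in five reals with zero sum. Fix the sum of the first two
  and the sums of squares of both groups. Then \<open>W\<close> depends on the last three only through the product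
  \<open>e\<close> of their deviations from their mean, and its minimum is attained when two of them
  coincide. This leaves polynomials in few variables that factor or are sums of squares.\<close>

subsection \<open>Inequalities for five reals with zero sum\<close>

text \<open>The gap factors: 2 r^3 - z1 z2 z3 = (2 r - z1) (z1 + r)^2, and z1 \<le> 2 r because z2
  and z3 are real. Equality holds at the rearrangements of (2r, -r, -r).\<close>

lemma prod3_le_of_sum_eq_0:
  fixes z1 z2 z3 r :: real
  assumes "z1 + z2 + z3 = 0" "z1\<^sup>2 + z2\<^sup>2 + z3\<^sup>2 = 6 * r\<^sup>2" "r \<ge> 0"
  shows "z1 * z2 * z3 \<le> 2 * r ^ 3"
proof -
  have z3: "z3 = - z1 - z2" using assms(1) by simp
  have e2: "z1\<^sup>2 + z2\<^sup>2 + z1 * z2 = 3 * r\<^sup>2"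
    using assms(2) unfolding z3 by (simp add: power2_eq_square algebra_simps)
  have "0 \<le> (z1 + 2 * z2)\<^sup>2"
    by simp
  also have "\<dots> = 3 * ((2 * r)\<^sup>2 - z1\<^sup>2)"
    using e2 by (simp add: power2_eq_square algebra_simps)
  finally have "z1\<^sup>2 \<le> (2 * r)\<^sup>2"
    by simp
  then have "z1 \<le> 2 * r"
    by (rule power2_le_imp_le) (use assms(3) in simp)
  then have "(z1 - 2 * r) * (z1 + r)\<^sup>2 \<le> 0"
    by (intro mult_nonpos_nonneg) auto
  moreover have "z1 * z2 * z3 - 2 * r ^ 3 = (z1 - 2 * r) * (z1 + r)\<^sup>2"
  proof -
    have "z1 * z2 * z3 = z1 * (z1\<^sup>2 - (z1\<^sup>2 + z2\<^sup>2 + z1 * z2))"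
      unfolding z3 by (simp add: power2_eq_square algebra_simps)
    then show ?thesis unfolding e2 by algebra
  qed
  ultimately show ?thesis by linarith
qed

text \<open>Here v is the sum of the squared deviations of x1, x2 from their mean a/2, 6 r^2 is that
  of the other three from their mean -a/3, and e is the product of these three deviations. As the
  three sum to 0, their cubes sum to 3 e and their fourth powers to 18 r^4, so e enters only
  linearly.\<close>

lemma five_reals_split:
  fixes x1 x2 x3 x4 x5 :: real
  assumes "x1 + x2 + x3 + x4 + x5 = 0"
  obtains a v r e where "a = x1 + x2" "v \<ge> 0" "r \<ge> 0" "e \<le> 2 * r ^ 3"
    "x1\<^sup>2 + x2\<^sup>2 + x3\<^sup>2 + x4\<^sup>2 + x5\<^sup>2 = 5/6 * a\<^sup>2 + v + 6 * r\<^sup>2"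
    "x1 ^ 4 + x2 ^ 4 + x3 ^ 4 + x4 ^ 4 + x5 ^ 4 =
      35/216 * a ^ 4 + 3/2 * a\<^sup>2 * v + v\<^sup>2 / 2 + 4 * a\<^sup>2 * r\<^sup>2 - 4 * a * e + 18 * r ^ 4"
proof -
  define a v where "a = x1 + x2" and "v = 1/2 * (x1 - x2)\<^sup>2"
  define z3 z4 z5 where "z3 = x3 + a / 3" and "z4 = x4 + a / 3" and "z5 = x5 + a / 3"
  define r where "r = sqrt ((z3\<^sup>2 + z4\<^sup>2 + z5\<^sup>2) / 6)"
  have z: "z3 + z4 + z5 = 0" 
    using assms unfolding a_def z3_def z4_def z5_def by (simp add: field_simps)
  have r: "r \<ge> 0" "z3\<^sup>2 + z4\<^sup>2 + z5\<^sup>2 = 6 * r\<^sup>2"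
    by (simp_all add: r_def)
  have x: "x3 = z3 - 1/3 * a" "x4 = z4 - 1/3 * a" "x5 = - z3 - z4 - 1/3 * a" "z5 = - z3 - z4"
    using z by (simp_all add: z3_def z4_def z5_def)
  have x12: "x1\<^sup>2 + x2\<^sup>2 = 1/2 * a\<^sup>2 + v"
    unfolding a_def v_def by algebra
  have x12': "x1 ^ 4 + x2 ^ 4 = 1/8 * a ^ 4 + 3/2 * a\<^sup>2 * v + 1/2 * v\<^sup>2"
    unfolding a_def v_def by algebra
  have r2: "r\<^sup>2 = 1/3 * (z3\<^sup>2 + z4\<^sup>2 + z3 * z4)"
    using r(2) unfolding x(4) by (simp add: power2_eq_square algebra_simps)
  have r4: "r ^ 4 = (1/3 * (z3\<^sup>2 + z4\<^sup>2 + z3 * z4))\<^sup>2"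
    unfolding r2[symmetric] by simp
  have 1: "x3\<^sup>2 + x4\<^sup>2 + x5\<^sup>2 = 1/3 * a\<^sup>2 + 6 * r\<^sup>2"
    unfolding x r2 by algebra
  have 2: "x3 ^ 4 + x4 ^ 4 + x5 ^ 4 = 1/27 * a ^ 4 + 4 * a\<^sup>2 * r\<^sup>2 - 4 * a * (z3 * z4 * z5) + 18 * r ^ 4"
    unfolding x r4 r2 by algebra
  show thesis
  proof (rule that[of a v r "z3 * z4 * z5"])
    show "z3 * z4 * z5 \<le> 2 * r ^ 3"
      using prod3_le_of_sum_eq_0 z r by blast
  qed (use 1 2 x12 x12' r in \<open>auto simp: a_def v_def\<close>)
qed

text \<open>The constant 7/30 is attained at (3, 3, -2, -2, -2). For a \<ge> 0 the term -4 a e is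
  smallest at e = 2 r^3, and what is then left is a nonnegative combination of squares.\<close>

lemma sum_fourth_powers_ge:
  fixes x1 x2 x3 x4 x5 :: real
  assumes "x1 + x2 + x3 + x4 + x5 = 0"
  shows "7 * (x1\<^sup>2 + x2\<^sup>2 + x3\<^sup>2 + x4\<^sup>2 + x5\<^sup>2)\<^sup>2 \<le> 30 * (x1 ^ 4 + x2 ^ 4 + x3 ^ 4 + x4 ^ 4 + x5 ^ 4)"
proof -
  have *: "7 * (x1\<^sup>2 + x2\<^sup>2 + x3\<^sup>2 + x4\<^sup>2 + x5\<^sup>2)\<^sup>2 \<le> 30 * (x1 ^ 4 + x2 ^ 4 + x3 ^ 4 + x4 ^ 4 + x5 ^ 4)"
    if s: "x1 + x2 + x3 + x4 + x5 = 0" and pos: "x1 + x2 \<ge> 0" for x1 x2 x3 x4 x5 :: real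
  proof -
    obtain a v r e where a: "a = x1 + x2" "v \<ge> 0" "r \<ge> 0" "e \<le> 2 * r ^ 3"
      and t: "x1\<^sup>2 + x2\<^sup>2 + x3\<^sup>2 + x4\<^sup>2 + x5\<^sup>2 = 5/6 * a\<^sup>2 + v + 6 * r\<^sup>2"
      and q: "x1 ^ 4 + x2 ^ 4 + x3 ^ 4 + x4 ^ 4 + x5 ^ 4 =
        35/216 * a ^ 4 + 3/2 * a\<^sup>2 * v + v\<^sup>2 / 2 + 4 * a\<^sup>2 * r\<^sup>2 - 4 * a * e + 18 * r ^ 4"
      by (rule five_reals_split[OF s])
    \<comment> \<open>For e = 2 r^3 the zeros are v = r = 0, or v = 0 and a = 12 r/5, or a = 3 r/5
      and v = 9 r^2/2: the rearranged multiples of (3, 3, -2, -2, -2).\<close>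
    have "0 \<le> 8 * (v - 5/2 * r * (12/5 * r - a))\<^sup>2 + 100/3 * v * (a - 3/5 * r)\<^sup>2 + 120 * a * (2 * r ^ 3 - e)"
      using a pos by simp
    also have "\<dots> = 30 * (35/216 * a ^ 4 + 3/2 * a\<^sup>2 * v + v\<^sup>2 / 2 + 4 * a\<^sup>2 * r\<^sup>2 - 4 * a * e + 18 * r ^ 4)
        - 7 * (5/6 * a\<^sup>2 + v + 6 * r\<^sup>2)\<^sup>2"
      by algebra
    finally show ?thesis unfolding t q by simp
  qed
  show ?thesis
  proof (cases "x1 + x2 \<ge> 0")
    case True
    then show ?thesis using * assms by blast
  next
    case False
    \<comment> \<open>Both sides are even in x, so a change of sign makes the sum of the first two
      nonnegative.\<close>
    then show ?thesis using *[of "-x1" "-x2" "-x3" "-x4" "-x5"] assms by simp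
  qed
qed

text \<open>Inserting q \<ge> 7/30 t^2 leaves a polynomial in t alone, the square (t - 30)^2 / 12.
  In rescaled units this is V \<ge> 0, which settles the third case of the lower bound.\<close>

lemma quartic_nonneg:
  fixes x1 x2 x3 x4 x5 :: real
  assumes "x1 + x2 + x3 + x4 + x5 = 0"
  defines "t \<equiv> x1\<^sup>2 + x2\<^sup>2 + x3\<^sup>2 + x4\<^sup>2 + x5\<^sup>2"
  shows "0 \<le> 75 - 5 * t - 3/20 * t\<^sup>2 + (x1 ^ 4 + x2 ^ 4 + x3 ^ 4 + x4 ^ 4 + x5 ^ 4)"
proof -
  have "75 - 5 * t + t\<^sup>2 / 12 = (t - 30)\<^sup>2 / 12"
    by algebra
  moreover have "0 \<le> (t - 30)\<^sup>2 / 12"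
    by simp
  ultimately have "0 \<le> 75 - 5 * t + t\<^sup>2 / 12"
    by linarith
  then show ?thesis
    using sum_fourth_powers_ge[OF assms(1)] unfolding t_def[symmetric] by simp
qed

text \<open>\<open>L = r/2 - m/12\<close> is the linearization of \<open>s\<close> at the line \<open>6r + 5m = 0\<close> where equality holds. With
  \<open>s\<close> replaced by \<open>L\<close>, the cubic and the quartic part both contain the factor \<open>(6r + 5m)\<^sup>2\<close>.\<close>

lemma well_bound_reduced:
  fixes m r s :: real
  assumes r: "r \<ge> 0" and s: "0 \<le> s" "s \<le> 1/2" and D: "20 * s\<^sup>2 = 5/6 * m\<^sup>2 + 6 * r\<^sup>2"
  shows "0 \<le> - 260 * s ^ 4 - 60 * m * s\<^sup>2 + 400 * s ^ 3 + 35/9 * m ^ 3 + 48 * m * r\<^sup>2 - 48 * r ^ 3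
    + 35/216 * m ^ 4 + 4 * m\<^sup>2 * r\<^sup>2 - 8 * m * r ^ 3 + 18 * r ^ 4" (is "0 \<le> ?G")
proof -
  define L where "L = 1/2 * r - 1/12 * m"
  define K where "K = (6 * r + 5 * m)\<^sup>2"
  have sL: "s\<^sup>2 - L\<^sup>2 = K / 720"
    using D unfolding L_def K_def by (simp add: power2_eq_square field_simps)
  moreover have "0 \<le> K / 720" by (simp add: K_def)
  ultimately have "L\<^sup>2 \<le> s\<^sup>2" by linarith
  then have Ls: "L \<le> s" using s power2_le_imp_le by blast
  \<comment> \<open>As s + L \<le> 2 s, the difference s - L is at least K / (1440 s); products
    replace the division, since s may be 0.\<close>
  have "2 * s * (s - L) \<ge> (s + L) * (s - L)"
    using Ls by (intro mult_right_mono) auto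
  also have "(s + L) * (s - L) = K / 720"
    using sL by (simp add: power2_eq_square algebra_simps)
  finally have "s * (400 * s * (s - L)) \<ge> s * (5/18 * K)"
    using s by (intro mult_left_mono) auto
  then have 1: "400 * s ^ 3 \<ge> 400 * s\<^sup>2 * L + 5/18 * s * K"
    by (simp add: power2_eq_square power3_eq_cube algebra_simps)
  have m: "m\<^sup>2 \<le> 24 * s\<^sup>2" "m\<^sup>2 \<le> 9" and r2: "r\<^sup>2 \<le> 1"
    using D power_mono[OF s(2) s(1), of 2] zero_le_power2[of m] zero_le_power2[of r]
    unfolding power_one_over by (simp_all only: power2_eq_square)
  have s2: "s\<^sup>2 \<le> s / 2"
    using s mult_left_mono[OF s(2) s(1)] by (simp add: power2_eq_square)
  have "m \<ge> - 3"
    using m(2) abs_le_square_iff[of m 3] by auto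
  then have mr: "m * r \<ge> - 3 * r"
    using r by (rule mult_right_mono)
  have "r \<le> 1" using r2 r power2_le_imp_le[of r 1] by simp
  then have "r\<^sup>2 \<le> r"
    using r mult_left_mono[of r 1 r] by (simp add: power2_eq_square)
  \<comment> \<open>The m^2 term is absorbed by s, since m^2 \<le> 24 s^2 \<le> 12 s; the m r and
    r^2 terms are absorbed by r/3, since m \<ge> -3 and r \<le> 1.\<close>
  then have "0 \<le> 1/3 * r + 5/18 * s - 5/432 * m\<^sup>2 + 1/36 * m * r - 3/20 * r\<^sup>2"
    using mr m(1) s2 r s by (simp add: field_simps)
  then have "0 \<le> K * (1/3 * r + 5/18 * s - 5/432 * m\<^sup>2 + 1/36 * m * r - 3/20 * r\<^sup>2)"
    unfolding K_def by simp
  \<comment> \<open>The term 400 s^3 is exchanged for its lower bound and \<open>D\<close>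
    eliminates s^2 and s^4; a multiple of \<open>K\<close> remains.\<close>
  also have "\<dots> = ?G - (400 * s ^ 3 - 400 * s\<^sup>2 * L - 5/18 * s * K)"
  proof -
    have s2': "s\<^sup>2 = 1/24 * m\<^sup>2 + 3/10 * r\<^sup>2" using D by simp
    have s4: "s ^ 4 = (1/24 * m\<^sup>2 + 3/10 * r\<^sup>2)\<^sup>2" unfolding s2'[symmetric] by simp
    show ?thesis unfolding s4 s2' L_def K_def
      by algebra
  qed
  finally show ?thesis using 1 by linarith
qed

text \<open>As the sum is 0, \<open>D\<close> says that the squared distance from x to (3, 3, -2,
  -2, -2) is 20 s^2; the left side is W at parameter s of the segment between the vacua. The case v
  = 0, e = 2 r^3 is \<open>well_bound_reduced\<close>, and the contributions of v and e beyond it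
  are nonnegative.\<close>

lemma well_bound:
  fixes x1 x2 x3 x4 x5 s :: real
  assumes sum: "x1 + x2 + x3 + x4 + x5 = 0"
    and s: "0 \<le> s" "s \<le> 1/2"
  defines "t \<equiv> x1\<^sup>2 + x2\<^sup>2 + x3\<^sup>2 + x4\<^sup>2 + x5\<^sup>2"
  assumes D: "t + 30 - 10 * (x1 + x2) = 20 * s\<^sup>2"
  shows "200 * s\<^sup>2 * (1 - s)\<^sup>2 \<le> 75 - 5 * t - 3/20 * t\<^sup>2 + (x1 ^ 4 + x2 ^ 4 + x3 ^ 4 + x4 ^ 4 + x5 ^ 4)"
proof -
  obtain a v r e where a: "a = x1 + x2" "v \<ge> 0" "r \<ge> 0" "e \<le> 2 * r ^ 3"
    and t: "t = 5/6 * a\<^sup>2 + v + 6 * r\<^sup>2"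
    and q: "x1 ^ 4 + x2 ^ 4 + x3 ^ 4 + x4 ^ 4 + x5 ^ 4 =
      35/216 * a ^ 4 + 3/2 * a\<^sup>2 * v + v\<^sup>2 / 2 + 4 * a\<^sup>2 * r\<^sup>2 - 4 * a * e + 18 * r ^ 4"
    using five_reals_split[OF sum] unfolding t_def by metis
  define m where "m = a - 6"
  \<comment> \<open>The value of s that belongs to v = 0 with the same a and r.\<close>
  define s0 where "s0 = sqrt ((5/6 * m\<^sup>2 + 6 * r\<^sup>2) / 20)"
  have s0: "s0 \<ge> 0" "20 * s0\<^sup>2 = 5/6 * m\<^sup>2 + 6 * r\<^sup>2"
    unfolding s0_def by auto
  have D': "20 * s\<^sup>2 = 20 * s0\<^sup>2 + v"
    using D a(1) unfolding t s0(2) m_def by (simp add: power2_eq_square algebra_simps)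
  then have "s0\<^sup>2 \<le> s\<^sup>2" using a(2) by simp
  then have s0s: "s0 \<le> s" using s(1) power2_le_imp_le by blast
  then have s0h: "s0 \<le> 1/2" using s by simp
  have m2: "m\<^sup>2 \<le> 24 * s0\<^sup>2" using s0(2) zero_le_power2[of r] by linarith
  \<comment> \<open>The constant 5 rounds up the square root of 24. The resulting m \<ge> -5/2 makes
    a positive, so that e may be replaced by its upper bound.\<close>
  have "m\<^sup>2 \<le> (5 * s0)\<^sup>2" using m2 zero_le_power2[of s0] unfolding power_mult_distrib power2_eq_square[of 5] by linarith
  then have m: "m \<ge> - 5 * s0" using s0 abs_le_square_iff[of m "5 * s0"] by simp
  then have a0: "a \<ge> 0" using s0h unfolding m_def by simp
  \<comment> \<open>Convexity of y^(3/2): its tangent at y = s0^2, evaluated at y = s^2 = s0^2 +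
    v/20.\<close>
  have s3: "400 * s ^ 3 \<ge> 400 * s0 ^ 3 + 30 * s0 * v"
  proof -
    have "0 \<le> 200 * (s - s0)\<^sup>2 * (2 * s + s0)" using s s0 by simp
    also have "\<dots> = 400 * s ^ 3 - 400 * s0 ^ 3 - 30 * s0 * (20 * s\<^sup>2 - 20 * s0\<^sup>2)"
      by algebra
    finally show ?thesis using D' by simp
  qed
  have v: "v \<le> 5 - 20 * s0\<^sup>2"
    using D' power_mono[OF s(2) s(1), of 2] by (simp add: power2_eq_square)
  \<comment> \<open>This is the coefficient of v in the decomposition below; 30 s0 comes from the
    tangent bound. The square of m is bounded by its tangent at -5 s0, after which m = -5 s0 is the
    worst case.\<close>
  have "0 \<le> 30 + 15 * m + 3/2 * m\<^sup>2 - 26 * s0\<^sup>2 - 3/20 * v + 30 * s0"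
  proof -
    have "0 \<le> 3/2 * (m + 5 * s0)\<^sup>2" by simp
    then have 1: "15 * m + 3/2 * m\<^sup>2 \<ge> 15 * m - 15 * (m * s0) - 75/2 * s0\<^sup>2"
      by (simp add: power2_eq_square algebra_simps)
    have "(15 - 15 * s0) * m \<ge> (15 - 15 * s0) * (- 5 * s0)"
      using m s0h by (intro mult_left_mono) auto
    then have 2: "15 * m - 15 * (m * s0) \<ge> 75 * s0\<^sup>2 - 75 * s0"
      by (simp add: power2_eq_square algebra_simps)
    show ?thesis using 1 2 v s0h zero_le_power2[of s0] by linarith
  qed
  then have V: "0 \<le> v * (30 + 15 * m + 3/2 * m\<^sup>2 - 26 * s0\<^sup>2 - 3/20 * v + 30 * s0)"
    using a(2) by simp
  have E: "0 \<le> 4 * a * (2 * r ^ 3 - e)" using a0 a by simp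
  note well_bound_reduced[OF a(3) s0(1) s0h s0(2)]
  moreover have "75 - 5 * t - 3/20 * t\<^sup>2 + (x1 ^ 4 + x2 ^ 4 + x3 ^ 4 + x4 ^ 4 + x5 ^ 4) - 200 * s\<^sup>2 * (1 - s)\<^sup>2
    = (- 260 * s0 ^ 4 - 60 * m * s0\<^sup>2 + 400 * s0 ^ 3 + 35/9 * m ^ 3 + 48 * m * r\<^sup>2 - 48 * r ^ 3
    + 35/216 * m ^ 4 + 4 * m\<^sup>2 * r\<^sup>2 - 8 * m * r ^ 3 + 18 * r ^ 4)
     + v * (30 + 15 * m + 3/2 * m\<^sup>2 - 26 * s0\<^sup>2 - 3/20 * v + 30 * s0)
     + 4 * a * (2 * r ^ 3 - e) + (400 * s ^ 3 - 400 * s0 ^ 3 - 30 * s0 * v)"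
  proof -
    have A: "a = m + 6" by (simp add: m_def)
    have s02: "s0\<^sup>2 = 1/24 * m\<^sup>2 + 3/10 * r\<^sup>2" using s0(2) by simp
    have s04: "s0 ^ 4 = (1/24 * m\<^sup>2 + 3/10 * r\<^sup>2)\<^sup>2" unfolding s02[symmetric] by simp
    have s2: "s\<^sup>2 = 1/24 * m\<^sup>2 + 3/10 * r\<^sup>2 + 1/20 * v" using D' s0(2) by simp
    have W: "200 * s\<^sup>2 * (1 - s)\<^sup>2 = 200 * s\<^sup>2 + 200 * (s\<^sup>2)\<^sup>2 - 400 * s ^ 3"
      by algebra
    have X: "75 - 5 * t - 3/20 * t\<^sup>2 + (35/216 * a ^ 4 + 3/2 * a\<^sup>2 * v + 1/2 * v\<^sup>2 + 4 * a\<^sup>2 * r\<^sup>2 + 18 * r ^ 4)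
        - 200 * s\<^sup>2 - 200 * (s\<^sup>2)\<^sup>2
      = - 260 * s0 ^ 4 - 60 * m * s0\<^sup>2 + 35/9 * m ^ 3 + 48 * m * r\<^sup>2
        + 35/216 * m ^ 4 + 4 * m\<^sup>2 * r\<^sup>2 + 18 * r ^ 4
        + v * (30 + 15 * m + 3/2 * m\<^sup>2 - 26 * s0\<^sup>2 - 3/20 * v)"
      unfolding t s04 s02 s2 A by algebra
    have Y: "4 * a * (2 * r ^ 3 - e) = 48 * r ^ 3 + 8 * m * r ^ 3 - 4 * a * e"
      unfolding A by (simp add: algebra_simps)
    have Z: "v * (30 + 15 * m + 3/2 * m\<^sup>2 - 26 * s0\<^sup>2 - 3/20 * v + 30 * s0)
        = v * (30 + 15 * m + 3/2 * m\<^sup>2 - 26 * s0\<^sup>2 - 3/20 * v) + 30 * s0 * v"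
      by (simp add: algebra_simps)
    show ?thesis unfolding W q Y Z using X by linarith
  qed
  ultimately show ?thesis using V E s3 by linarith
qed

subsection \<open>Complex matrices and the spectral theorem\<close>

lemmas mult_if_distribs =
  if_distrib[where f="\<lambda>x. a * x" for a] if_distrib[where f="\<lambda>x. x * a" for a] if_distribR

lemma scaleR_matrix_mult_left: "(c *\<^sub>R A) ** B = c *\<^sub>R (A ** B)" for A :: "complex^'n^'m"
  by (simp add: vec_eq_iff matrix_matrix_mult_def scaleR_sum_right)

lemma scaleR_matrix_mult_right: "A ** (c *\<^sub>R B) = c *\<^sub>R (A ** B)" for A :: "complex^'n^'m"
  by (simp add: vec_eq_iff matrix_matrix_mult_def scaleR_sum_right)

lemma matrix_diff_ldistrib: "A ** (B - C) = A ** B - A ** C" for A :: "complex^'n^'m"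
  by (simp add: vec_eq_iff matrix_matrix_mult_def sum_subtractf algebra_simps)

lemma matrix_diff_rdistrib: "(A - B) ** C = A ** C - B ** C" for A :: "complex^'n^'m"
  by (simp add: vec_eq_iff matrix_matrix_mult_def sum_subtractf algebra_simps)

lemma trace_scaleR: "trace (c *\<^sub>R A) = c *\<^sub>R trace A" for A :: "complex^'n^'n"
  by (simp add: trace_def scaleR_sum_right)

lemma dagger_mat_1 [simp]: "dagger (mat 1) = mat 1"
  by (simp add: vec_eq_iff mat_def)

lemma dagger_scaleR: "dagger (c *\<^sub>R A) = c *\<^sub>R dagger A"
  by (simp add: vec_eq_iff)

lemma dagger_diag_mat [simp]: "dagger (diag_mat a) = diag_mat a"
  by (simp add: vec_eq_iff diag_mat_def)

lemma diag_mat_mult: "diag_mat a ** diag_mat b = diag_mat (\<chi> i. a $ i * b $ i)"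
  by (simp add: vec_eq_iff diag_mat_def matrix_matrix_mult_def mult_if_distribs cong: if_cong)

lemma trace_diag_mat: "trace (diag_mat a) = of_real (\<Sum>i\<in>UNIV. a $ i)"
  by (simp add: trace_def diag_mat_def)

lemma trace_mult_diag_mat: "trace (A ** diag_mat a) = (\<Sum>i\<in>UNIV. A $ i $ i * of_real (a $ i))"
  by (simp add: trace_def diag_mat_def matrix_matrix_mult_def mult_if_distribs cong: if_cong)

definition unitary_matrices :: "(complex^'n^'n) set" where
  "unitary_matrices = {U. dagger U ** U = mat 1 \<and> U ** dagger U = mat 1}"

lemma special_unitary_subset_unitary: "special_unitary \<subseteq> unitary_matrices"
  by (auto simp: special_unitary_def unitary_matrices_def)

lemma unitary_mult:
  assumes "U \<in> unitary_matrices" "V \<in> unitary_matrices"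
  shows "U ** V \<in> unitary_matrices"
proof -
  have "dagger V ** dagger U ** (U ** V) = dagger V ** (dagger U ** U) ** V"
    and "U ** V ** (dagger V ** dagger U) = U ** (V ** dagger V) ** dagger U"
    by (simp_all only: matrix_mul_assoc)
  then show ?thesis
    using assms by (simp add: unitary_matrices_def dagger_mult)
qed

lemma unitary_dagger: "U \<in> unitary_matrices \<Longrightarrow> dagger U \<in> unitary_matrices"
  by (simp add: unitary_matrices_def)

lemma det_dagger: "det (dagger U) = cnj (det U)"
proof -
  have "det (dagger U) = det (map_matrix cnj U)"
    using det_transpose[of "map_matrix cnj U"]
    by (simp add: dagger_def map_matrix_def transpose_def)
  also have "\<dots> = cnj (det U)"
    by (simp add: det_def map_matrix_def)
  finally show ?thesis .
qed

text \<open>The conjugate of det U, placed in one diagonal entry, corrects the determinant; a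
  diagonal matrix of phases commutes with every diagonal matrix.\<close>

lemma unitary_phase:
  fixes U :: "complex^'n^'n"
  assumes U: "U \<in> unitary_matrices"
  obtains D where "D ** U \<in> special_unitary" "\<And>a. dagger D ** diag_mat a ** D = diag_mat a"
proof -
  have "dagger U ** U = mat 1"
    using U by (simp add: unitary_matrices_def)
  then have d: "cnj (det U) * det U = 1"
    using det_mul[of "dagger U" U] by (simp add: det_dagger)
  obtain k :: 'n where True by simp
  define p where "p i = (if i = k then cnj (det U) else 1)" for i
  define D :: "complex^'n^'n" where "D = (\<chi> i j. if i = j then p i else 0)"
  have p: "cnj (p i) * p i = 1" "p i * cnj (p i) = 1" for i
    using d by (simp_all add: p_def mult.commute)
  have p2: "cnj (p i) * (x * p i) = x" for i x
    using p(1)[of i] by (metis mult.left_commute mult.right_neutral)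
  have "dagger D ** D = mat 1" "D ** dagger D = mat 1"
    by (simp_all add: vec_eq_iff D_def mat_def matrix_matrix_mult_def p if_distrib[where f=cnj] mult_if_distribs cong: if_cong)
  then have "D \<in> unitary_matrices"
    by (simp add: unitary_matrices_def)
  moreover have "det D = cnj (det U)"
    by (subst det_diagonal) (auto simp: D_def p_def)
  ultimately have "D ** U \<in> special_unitary"
    using unitary_mult[OF _ U, of D] d by (simp add: special_unitary_def unitary_matrices_def det_mul)
  moreover have "dagger D ** diag_mat a ** D = diag_mat a" for a
    by (simp add: vec_eq_iff D_def diag_mat_def matrix_matrix_mult_def p2 mult.assoc if_distrib[where f=cnj] mult_if_distribs cong: if_cong)
  ultimately show thesis by (rule that)
qed

section \<open>Rank-one matrices and Householder reflections\<close>

definition outer :: "complex^'n \<Rightarrow> complex^'n^'n" where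
  "outer w = (\<chi> i j. w $ i * cnj (w $ j))"

definition quad_form :: "complex^'n^'n \<Rightarrow> complex^'n \<Rightarrow> complex" where
  "quad_form M w = (\<Sum>j\<in>UNIV. \<Sum>k\<in>UNIV. cnj (w $ j) * M $ j $ k * w $ k)"

lemma dagger_outer [simp]: "dagger (outer w) = outer w"
  by (simp add: vec_eq_iff outer_def mult.commute)

lemma trace_outer_mult: "trace (outer w ** M) = quad_form M w"
proof -
  have "trace (outer w ** M) = (\<Sum>i\<in>UNIV. \<Sum>k\<in>UNIV. w $ i * cnj (w $ k) * M $ k $ i)"
    by (simp add: trace_def outer_def matrix_matrix_mult_def)
  also have "\<dots> = quad_form M w"
    unfolding quad_form_def by (subst sum.swap) (simp add: mult_ac)
  finally show ?thesis .
qed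

text \<open>\<open>outer w\<close> is the column w times its adjoint row, so the middle of the
  product collapses to the scalar \<open>quad_form M w\<close>. The form is entrywise because this
  scalar is complex, while \<open>*\<^sub>R\<close> scales by reals.\<close>

lemma outer_mult_outer: "(outer w ** M ** outer w) $ i $ l = quad_form M w * outer w $ i $ l"
proof -
  have "(outer w ** M ** outer w) $ i $ l
      = (\<Sum>k\<in>UNIV. (\<Sum>j\<in>UNIV. w $ i * cnj (w $ j) * M $ j $ k) * (w $ k * cnj (w $ l)))"
    by (simp add: outer_def matrix_matrix_mult_def)
  also have "\<dots> = (\<Sum>k\<in>UNIV. \<Sum>j\<in>UNIV. w $ i * (cnj (w $ j) * M $ j $ k * w $ k) * cnj (w $ l))"
    by (simp add: sum_distrib_right sum_distrib_left mult_ac)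
  also have "\<dots> = (\<Sum>j\<in>UNIV. \<Sum>k\<in>UNIV. w $ i * (cnj (w $ j) * M $ j $ k * w $ k) * cnj (w $ l))"
    by (rule sum.swap)
  also have "\<dots> = w $ i * quad_form M w * cnj (w $ l)"
    unfolding quad_form_def by (simp only: sum_distrib_left sum_distrib_right)
  also have "\<dots> = quad_form M w * outer w $ i $ l"
    by (simp add: outer_def)
  finally show ?thesis .
qed

lemma trace_outer_outer: "trace (outer w ** A ** outer w ** B) = quad_form A w * quad_form B w"
proof -
  have "trace (outer w ** A ** outer w ** B) = quad_form A w * trace (outer w ** B)"
    unfolding trace_def
    by (simp add: matrix_matrix_mult_def[of "outer w ** A ** outer w" B] matrix_matrix_mult_def[of "outer w" B]
       outer_mult_outer sum_distrib_left mult_ac)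
  then show ?thesis by (simp add: trace_outer_mult)
qed

lemma quad_form_mat_1: "quad_form (mat 1) w = of_real ((norm w)\<^sup>2)"
proof -
  have "quad_form (mat 1) w = (\<Sum>j\<in>UNIV. of_real ((cmod (w $ j))\<^sup>2))"
    by (simp add: quad_form_def mat_def mult_if_distribs complex_norm_square mult.commute[of "cnj _"] del: of_real_power cong: if_cong)
  then show ?thesis
    by (simp add: norm_vec_def L2_set_def sum_nonneg)
qed

text \<open>The reflection in the hyperplane orthogonal to w. For w = 0 the quotient is 0 and the
  matrix is the identity.\<close>

definition householder :: "complex^'n \<Rightarrow> complex^'n^'n" where
  "householder w = mat 1 - (2 / (norm w)\<^sup>2) *\<^sub>R outer w"

lemma dagger_householder [simp]: "dagger (householder w) = householder w"
  by (simp add: householder_def dagger_diff dagger_scaleR)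

lemma householder_unitary: "householder w \<in> unitary_matrices"
proof (cases "w = 0")
  case True
  then show ?thesis by (simp add: householder_def unitary_matrices_def)
next
  case False
  have "outer w ** outer w = (norm w)\<^sup>2 *\<^sub>R outer w"
    using outer_mult_outer[of w "mat 1"] 
    by (simp add: vec_eq_iff quad_form_mat_1 scaleR_conv_of_real[where 'a=complex])
  moreover define c where "c = 2 / (norm w)\<^sup>2"
  ultimately have "householder w ** householder w = mat 1 - c *\<^sub>R outer w - c *\<^sub>R outer w
      + (c * (c * (norm w)\<^sup>2)) *\<^sub>R outer w"
    unfolding householder_def
    by (simp add: matrix_diff_ldistrib matrix_diff_rdistrib scaleR_matrix_mult_left scaleR_matrix_mult_right
        scaleR_right_diff_distrib)
  also have "c * (norm w)\<^sup>2 = 2"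
    using False by (simp add: c_def)
  also have "(c * 2) *\<^sub>R outer w = c *\<^sub>R outer w + c *\<^sub>R outer w"
    by (simp only: mult_2_right scaleR_left_distrib)
  finally have "householder w ** householder w = mat 1"
    by (simp only: diff_add_cancel diff_diff_add)
  then show ?thesis by (simp add: unitary_matrices_def)
qed

text \<open>An exact expansion, quadratic in c: it allows a maximum of the trace to be tested by
  finite variations, without derivatives.\<close>

lemma trace_householder_conj:
  fixes w :: "complex^'n"
  defines "c \<equiv> 2 / (norm w)\<^sup>2"
  shows "trace (householder w ** A ** householder w ** B) = trace (A ** B)
     - c *\<^sub>R (quad_form (A ** B) w + quad_form (B ** A) w) + c\<^sup>2 *\<^sub>R (quad_form A w * quad_form B w)"
proof -
  have "trace (A ** outer w ** B) = quad_form (B ** A) w"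
    using trace_mul_sym[of A "outer w ** B"] trace_outer_mult[of w "B ** A"]
    by (simp add: matrix_mul_assoc)
  moreover have "trace (outer w ** A ** B) = quad_form (A ** B) w"
    using trace_outer_mult[of w "A ** B"] by (simp add: matrix_mul_assoc)
  ultimately show ?thesis
    unfolding householder_def c_def[symmetric]
    by (simp add: matrix_diff_ldistrib matrix_diff_rdistrib scaleR_matrix_mult_left scaleR_matrix_mult_right
        trace_sub trace_scaleR trace_outer_outer scaleR_right_distrib scaleR_right_diff_distrib power2_eq_square)
qed

lemma quad_form_two_axes:
  fixes z :: complex
  assumes "i \<noteq> j"
  defines "w \<equiv> \<chi> k. if k = i then 1 else if k = j then z else 0"
  shows "quad_form M w = M $ i $ i + M $ i $ j * z + cnj z * M $ j $ i + cnj z * M $ j $ j * z"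
proof -
  have two: "(\<Sum>k\<in>UNIV. f k) = f i + f j" if "\<And>k. k \<noteq> i \<Longrightarrow> k \<noteq> j \<Longrightarrow> f k = 0" for f :: "_ \<Rightarrow> complex"
  proof -
    have "(\<Sum>k\<in>UNIV. f k) = (\<Sum>k\<in>{i, j}. f k)"
      using that by (intro sum.mono_neutral_right) auto
    then show ?thesis using assms(1) by simp
  qed
  have "quad_form M w = (\<Sum>a\<in>UNIV. cnj (w $ a) * M $ a $ i * w $ i + cnj (w $ a) * M $ a $ j * w $ j)"
    unfolding quad_form_def by (subst two) (auto simp: w_def)
  also have "\<dots> = M $ i $ i + M $ i $ j * z + cnj z * M $ j $ i + cnj z * M $ j $ j * z"
    using assms(1) by (subst two) (auto simp: w_def)
  finally show ?thesis .
qed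

text \<open>The test variations are Householder reflections in the plane of two coordinate axes; as
  \<open>z\<close> tends to 0 they tend to a diagonal sign matrix, which leaves the trace unchanged.\<close>

lemma trace_max_imp_diagonal:
  fixes A :: "complex^'n^'n" and b :: "real^'n"
  assumes herm: "dagger A = A"
    and max: "\<forall>R\<in>unitary_matrices.
      Re (trace (R ** A ** dagger R ** diag_mat b)) \<le> Re (trace (A ** diag_mat b))"
    and b: "b $ i \<noteq> b $ j"
  shows "A $ i $ j = 0" and "0 \<le> (b $ i - b $ j) * (Re (A $ i $ i) - Re (A $ j $ j))"
proof -
  have ij: "i \<noteq> j" using b by auto
  define N where "N = diag_mat b"
  define d where "d = b $ i - b $ j"
  define e where "e = Re (A $ i $ i) - Re (A $ j $ j)"
  have Aij: "A $ j $ i = cnj (A $ i $ j)"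
    using arg_cong[OF herm, of "\<lambda>M. M $ j $ i"] by simp
  have Akk: "Im (A $ k $ k) = 0" for k
    using arg_cong[OF herm, of "\<lambda>M. Im (M $ k $ k)"] by simp
  have AN: "(A ** N) $ k $ l = A $ k $ l * b $ l" "(N ** A) $ k $ l = b $ k * A $ k $ l" for k l
    by (simp_all add: N_def diag_mat_def matrix_matrix_mult_def mult_if_distribs cong: if_cong)
  \<comment> \<open>The left side is of first order in z and the right side of second order, so
    small z of suitable phase force the entry to vanish.\<close>
  have key: "Re (z * A $ i $ j) * (1 - (cmod z)\<^sup>2) * d \<le> (cmod z)\<^sup>2 * e * d" for z
  proof -
    define w :: "complex^'n" where "w = (\<chi> k. if k = i then 1 else if k = j then z else 0)"
    define \<nu> where "\<nu> = 1 + (cmod z)\<^sup>2"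
    define \<beta> where "\<beta> = Re (z * A $ i $ j)"
    note qf = quad_form_two_axes[OF ij, of _ z, folded w_def]
    have \<nu>: "\<nu> > 0" unfolding \<nu>_def by (smt (verit) zero_le_power2)
    have zz: "cnj z * x * z = of_real ((cmod z)\<^sup>2) * x" for x
      by (metis complex_norm_square mult.assoc mult.commute)
    have "of_real ((norm w)\<^sup>2) = (of_real \<nu> :: complex)"
      unfolding quad_form_mat_1[symmetric] qf \<nu>_def using ij by (simp add: mat_def zz[of 1, simplified])
    then have nw: "(norm w)\<^sup>2 = \<nu>" using of_real_eq_iff by blast
    have qA: "quad_form A w = of_real (Re (A $ i $ i) + (cmod z)\<^sup>2 * Re (A $ j $ j) + 2 * \<beta>)"
      unfolding qf zz Aij \<beta>_def using Akk by (simp add: complex_eq_iff algebra_simps)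
    have qN: "quad_form N w = of_real (b $ i + (cmod z)\<^sup>2 * b $ j)"
      unfolding qf zz N_def using ij by (simp add: diag_mat_def)
    have qAN: "Re (quad_form (A ** N) w + quad_form (N ** A) w)
        = 2 * (Re (A $ i $ i) * b $ i + (cmod z)\<^sup>2 * Re (A $ j $ j) * b $ j + \<beta> * (b $ i + b $ j))"
      unfolding qf zz AN Aij \<beta>_def using Akk by (simp add: algebra_simps)
    have "Re (trace (householder w ** A ** householder w ** N)) \<le> Re (trace (A ** N))"
      using bspec[OF max householder_unitary, of w] by (simp add: N_def)
    then have "(2 / \<nu>)\<^sup>2 * Re (quad_form A w * quad_form N w)
        \<le> (2 / \<nu>) * Re (quad_form (A ** N) w + quad_form (N ** A) w)"
      unfolding trace_householder_conj nw by simp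
    then have "(2 / \<nu>\<^sup>2) * (2 * Re (quad_form A w * quad_form N w))
        \<le> (2 / \<nu>\<^sup>2) * (\<nu> * Re (quad_form (A ** N) w + quad_form (N ** A) w))"
      using \<nu> by (simp add: power2_eq_square)
    then have "2 * Re (quad_form A w * quad_form N w) \<le> \<nu> * Re (quad_form (A ** N) w + quad_form (N ** A) w)"
      by (rule mult_left_le_imp_le) (use \<nu> in simp)
    then have "(Re (A $ i $ i) + (cmod z)\<^sup>2 * Re (A $ j $ j) + 2 * \<beta>) * (b $ i + (cmod z)\<^sup>2 * b $ j)
      \<le> \<nu> * (Re (A $ i $ i) * b $ i + (cmod z)\<^sup>2 * Re (A $ j $ j) * b $ j + \<beta> * (b $ i + b $ j))"
      unfolding qAN unfolding qA qN by (simp add: distrib_left)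
    moreover have "(cmod z)\<^sup>2 * e * d - \<beta> * (1 - (cmod z)\<^sup>2) * d =
      \<nu> * (Re (A $ i $ i) * b $ i + (cmod z)\<^sup>2 * Re (A $ j $ j) * b $ j + \<beta> * (b $ i + b $ j))
      - (Re (A $ i $ i) + (cmod z)\<^sup>2 * Re (A $ j $ j) + 2 * \<beta>) * (b $ i + (cmod z)\<^sup>2 * b $ j)"
      unfolding \<nu>_def d_def e_def by algebra
    ultimately show ?thesis
      unfolding \<beta>_def by linarith
  qed
  have d: "d \<noteq> 0" using b by (simp add: d_def)
  show 0: "A $ i $ j = 0"
  proof (rule ccontr)
    assume nz: "A $ i $ j \<noteq> 0"
    define B where "B = d\<^sup>2 * (cmod (A $ i $ j))\<^sup>2"
    have B: "B > 0" using nz d by (simp add: B_def)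
    \<comment> \<open>Chosen so that the second-order terms total less than 1/2, while the
      first-order term contributes 1 after division by \<epsilon> B.\<close>
    define \<epsilon> where "\<epsilon> = 1 / (2 * (1 + \<bar>e * d\<bar> + B))"
    have \<epsilon>: "\<epsilon> > 0" "\<epsilon> \<le> 1" "\<epsilon> * (1 + \<bar>e * d\<bar> + B) = 1/2"
      using B by (simp_all add: \<epsilon>_def field_simps)
    \<comment> \<open>This phase makes z times the entry real with the sign of \<open>d\<close>, so
      the first-order term is positive.\<close>
    define z where "z = of_real (\<epsilon> * d) * cnj (A $ i $ j)"
    have z: "Re (z * A $ i $ j) * d = \<epsilon> * B" "(cmod z)\<^sup>2 = \<epsilon>\<^sup>2 * B"
      by (simp_all add: z_def B_def norm_mult power_mult_distrib cmod_power2)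
        (simp_all add: power2_eq_square algebra_simps)
    have "\<epsilon> * B * (1 - \<epsilon>\<^sup>2 * B) \<le> \<epsilon>\<^sup>2 * B * e * d"
    proof -
      have "(Re (z * A $ i $ j) * d) * (1 - (cmod z)\<^sup>2) \<le> (cmod z)\<^sup>2 * e * d"
        using key[of z] by (simp only: mult_ac)
      then show ?thesis unfolding z .
    qed
    then have "\<epsilon> * B * (1 - \<epsilon>\<^sup>2 * B) \<le> \<epsilon> * B * (\<epsilon> * (e * d))"
      by (simp add: power2_eq_square mult_ac)
    then have "1 - \<epsilon>\<^sup>2 * B \<le> \<epsilon> * (e * d)"
      using \<epsilon> B by (simp add: mult_le_cancel_left_pos)
    moreover have "\<epsilon>\<^sup>2 * B \<le> \<epsilon> * B"
      using \<epsilon> B by (simp add: power2_eq_square)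
    moreover have "\<epsilon> * (e * d) \<le> \<epsilon> * \<bar>e * d\<bar>"
      using \<epsilon> by (intro mult_left_mono) auto
    moreover have "\<epsilon> + \<epsilon> * \<bar>e * d\<bar> + \<epsilon> * B = 1/2"
      using \<epsilon>(3) by (simp only: distrib_left mult_1_right)
    ultimately show False using \<epsilon>(1) by linarith
  qed
  \<comment> \<open>At z = 1 the reflection exchanges the two axes up to sign, and the first-order
    side of \<open>key\<close> vanishes.\<close>
  show "0 \<le> (b $ i - b $ j) * (Re (A $ i $ i) - Re (A $ j $ j))"
    using key[of 1] by (simp add: d_def e_def mult.commute)
qed

text \<open>The trace of U Q U^* \<open>diag_mat b\<close> attains its maximum on the compact
  special unitary group. At a maximizer the conjugate of Q is diagonal, because the entries of b are
  distinct, and its entries are ordered like those of b.\<close>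

theorem hermitian_diagonalization:
  fixes Q :: "complex^'n^'n" and b :: "real^'n"
  assumes herm: "dagger Q = Q" and inj: "\<And>i j. i \<noteq> j \<Longrightarrow> b $ i \<noteq> b $ j"
  obtains U a where "U \<in> special_unitary" "Q = dagger U ** diag_mat a ** U"
    "\<And>i j. b $ j \<le> b $ i \<Longrightarrow> a $ j \<le> a $ i"
proof -
  define f where "f U = Re (trace (U ** Q ** dagger U ** diag_mat b))" for U
  have "(mat 1 :: complex^'n^'n) \<in> special_unitary"
    by (simp add: special_unitary_def)
  then have "special_unitary \<noteq> ({} :: (complex^'n^'n) set)" by blast
  moreover have "continuous_on special_unitary f"
    unfolding f_def trace_def by (intro continuous_intros continuous_on_matrix_mult)
  ultimately obtain U where U: "U \<in> special_unitary" and max: "\<And>V. V \<in> special_unitary \<Longrightarrow> f V \<le> f U"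
    using continuous_attains_sup[OF compact_special_unitary] by metis
  define A where "A = U ** Q ** dagger U"
  have UU: "dagger U ** U = mat 1" "U \<in> unitary_matrices"
    using U by (auto simp: special_unitary_def unitary_matrices_def)
  have A: "dagger A = A"
    by (simp add: A_def dagger_mult herm matrix_mul_assoc)
  \<comment> \<open>Maximality passes from special unitary to all unitary matrices, since the
    correcting diagonal phase leaves the trace unchanged.\<close>
  have Amax: "\<forall>R\<in>unitary_matrices.
    Re (trace (R ** A ** dagger R ** diag_mat b)) \<le> Re (trace (A ** diag_mat b))"
  proof
    fix R :: "complex^'n^'n" assume R: "R \<in> unitary_matrices"
    obtain D where D: "D ** (R ** U) \<in> special_unitary" "dagger D ** diag_mat b ** D = diag_mat b"
      using unitary_phase[OF unitary_mult[OF R UU(2)]] by metis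
    have "f (D ** (R ** U)) = Re (trace (D ** (R ** A ** dagger R ** dagger D ** diag_mat b)))"
      by (simp add: f_def A_def dagger_mult matrix_mul_assoc)
    also have "\<dots> = Re (trace (R ** A ** dagger R ** (dagger D ** diag_mat b ** D)))"
      by (subst trace_mul_sym) (simp add: matrix_mul_assoc)
    finally have "f (D ** (R ** U)) = Re (trace (R ** A ** dagger R ** diag_mat b))"
      by (simp add: D)
    then show "Re (trace (R ** A ** dagger R ** diag_mat b)) \<le> Re (trace (A ** diag_mat b))"
      using max[OF D(1)] by (simp add: f_def A_def)
  qed
  note diag = trace_max_imp_diagonal[OF A Amax]
  define a :: "real^'n" where "a = (\<chi> i. Re (A $ i $ i))"
  have "Im (A $ k $ k) = 0" for k
    using arg_cong[OF A, of "\<lambda>M. Im (M $ k $ k)"] by simp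
  then have "A = diag_mat a"
    using diag(1)[OF inj] by (auto simp: vec_eq_iff a_def diag_mat_def complex_eq_iff)
  moreover have "dagger U ** A ** U = (dagger U ** U) ** Q ** (dagger U ** U)"
    by (simp only: A_def matrix_mul_assoc)
  ultimately have "Q = dagger U ** diag_mat a ** U"
    by (simp add: UU)
  moreover have "a $ j \<le> a $ i" if "b $ j \<le> b $ i" for i j
  proof (cases "i = j")
    case False
    then show ?thesis
      using diag(2)[OF inj[OF False]] inj[OF False] that by (auto simp: a_def zero_le_mult_iff)
  qed simp
  ultimately show thesis using that[OF U, of a] by simp
qed

subsection \<open>Distance to the vacuum orbits\<close>

lemma unitary_conj_mult:
  assumes "U \<in> unitary_matrices"
  shows "(dagger U ** A ** U) ** (dagger U ** B ** U) = dagger U ** (A ** B) ** U"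
proof -
  have "(dagger U ** A ** U) ** (dagger U ** B ** U) = dagger U ** A ** (U ** dagger U) ** B ** U"
    by (simp only: matrix_mul_assoc)
  also have "U ** dagger U = mat 1"
    using assms by (simp add: unitary_matrices_def)
  also have "dagger U ** A ** mat 1 ** B ** U = dagger U ** (A ** B) ** U"
    by (simp add: matrix_mul_assoc)
  finally show ?thesis .
qed

lemma trace_unitary_conj:
  assumes "U \<in> unitary_matrices"
  shows "trace (dagger U ** A ** U) = trace A"
proof -
  have "trace (dagger U ** A ** U) = trace (U ** dagger U ** A)"
    by (subst trace_mul_sym) (simp add: matrix_mul_assoc)
  then show ?thesis
    using assms by (simp add: unitary_matrices_def)
qed

lemma potential_unitary_conj:
  assumes "U \<in> unitary_matrices"
  shows "potential \<mu> h lam V\<^sub>0 (dagger U ** diag_mat a ** U) =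
    - \<mu>\<^sup>2 * (\<Sum>i\<in>UNIV. (a $ i)\<^sup>2) + h * (\<Sum>i\<in>UNIV. (a $ i)\<^sup>2)\<^sup>2 + lam * (\<Sum>i\<in>UNIV. (a $ i) ^ 4) + V\<^sub>0"
  unfolding potential_def
  by (simp add: unitary_conj_mult[OF assms] trace_unitary_conj[OF assms] diag_mat_mult trace_diag_mat
      power2_eq_square power4_eq_xxxx)

section \<open>Rearrangement for the squared moduli of a unitary matrix\<close>

lemma unitary_row_sum:
  assumes "R \<in> unitary_matrices"
  shows "(\<Sum>l\<in>UNIV. (cmod (R $ k $ l))\<^sup>2) = 1"
proof -
  have "(R ** dagger R) $ k $ k = 1"
    using assms by (simp add: unitary_matrices_def mat_def)
  then have "complex_of_real (\<Sum>l\<in>UNIV. (cmod (R $ k $ l))\<^sup>2) = of_real 1"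
    by (simp add: matrix_matrix_mult_def complex_norm_square del: of_real_power)
  then show ?thesis unfolding of_real_eq_iff .
qed

lemma unitary_column_sum:
  assumes "R \<in> unitary_matrices"
  shows "(\<Sum>k\<in>UNIV. (cmod (R $ k $ l))\<^sup>2) = 1"
  using unitary_row_sum[OF unitary_dagger[OF assms], of l] by simp

lemma trace_diag_conj:
  "trace (diag_mat a ** (R ** diag_mat p ** dagger R))
    = of_real (\<Sum>k\<in>UNIV. a $ k * (\<Sum>l\<in>UNIV. p $ l * (cmod (R $ k $ l))\<^sup>2))"
proof -
  have d: "(R ** diag_mat p ** dagger R) $ k $ k = of_real (\<Sum>l\<in>UNIV. p $ l * (cmod (R $ k $ l))\<^sup>2)" for k
    by (simp add: diag_mat_def matrix_matrix_mult_def complex_norm_square mult_ac mult_if_distribs del: of_real_power cong: if_cong)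
  show ?thesis
    by (subst trace_mul_sym) (simp add: trace_mult_diag_mat d mult.commute)
qed

text \<open>The partial row sums are weights in [0, 1] with total \<open>card I\<close>, so the
  weighted sum of c is largest when they are concentrated on I. Subtracting the threshold \<alpha>
  turns this into a comparison term by term.\<close>

lemma unitary_rearrangement:
  fixes R :: "complex^'n^'n" and c :: "'n \<Rightarrow> real"
  assumes R: "R \<in> unitary_matrices"
    and c: "\<And>k. k \<in> I \<Longrightarrow> \<alpha> \<le> c k" "\<And>k. k \<notin> I \<Longrightarrow> c k \<le> \<alpha>"
  shows "(\<Sum>k\<in>UNIV. c k * (\<Sum>l\<in>I. (cmod (R $ k $ l))\<^sup>2)) \<le> sum c I"
proof -
  define w where "w k = (\<Sum>l\<in>I. (cmod (R $ k $ l))\<^sup>2)" for k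
  have w0: "0 \<le> w k" for k
    by (simp add: w_def sum_nonneg)
  have w1: "w k \<le> 1" for k
    unfolding w_def unitary_row_sum[OF R, of k, symmetric] by (intro sum_mono2) auto
  have "sum w UNIV = (\<Sum>l\<in>I. \<Sum>k\<in>UNIV. (cmod (R $ k $ l))\<^sup>2)"
    unfolding w_def by (rule sum.swap)
  then have w: "sum w UNIV = card I"
    by (simp add: unitary_column_sum[OF R])
  have "(\<Sum>k\<in>UNIV. (c k - \<alpha>) * w k) \<le> (\<Sum>k\<in>UNIV. if k \<in> I then c k - \<alpha> else 0)"
  proof (rule sum_mono)
    fix k
    show "(c k - \<alpha>) * w k \<le> (if k \<in> I then c k - \<alpha> else 0)"
      using c[of k] w0[of k] w1[of k] by (auto simp: mult_nonpos_nonneg mult_left_le)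
  qed
  also have "\<dots> = (\<Sum>k\<in>I. c k - \<alpha>)"
    by (simp add: sum.If_cases)
  finally show ?thesis
    unfolding w_def[symmetric] using w 
    by (simp add: left_diff_distrib sum_subtractf flip: sum_distrib_left)
qed

text \<open>Both vacua are of this form: scale u on {1, 2} and scale -u on {3, 4}. This lets one
  argument treat both orbits.\<close>

definition level_vec :: "real \<Rightarrow> 5 set \<Rightarrow> real^5" where
  "level_vec \<kappa> I = (\<chi> i. \<kappa> * (if i \<in> I then 3 else - 2))"

lemma frob_square_diff:
  "Re (trace ((Q - P) ** (Q - P))) = Re (trace (Q ** Q)) - 2 * Re (trace (Q ** P)) + Re (trace (P ** P))"
  using trace_mul_sym[of P Q]
  by (simp add: matrix_diff_ldistrib matrix_diff_rdistrib trace_sub)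

text \<open>\<open>level_vec \<kappa> I\<close> is 5 \<kappa> on I minus the constant 2 \<kappa>.
  Since the rows of squared moduli sum to 1, the constant pairs with the trace of a, which is 0; 30
  \<kappa>^2 is the squared norm of the level vector.\<close>

lemma frob_diff_level:
  fixes a :: "real^5"
  assumes U: "U \<in> unitary_matrices" and V: "V \<in> unitary_matrices" and I: "card I = 2"
    and a: "(\<Sum>i\<in>UNIV. a $ i) = 0"
  shows "frob (dagger U ** diag_mat a ** U - dagger V ** diag_mat (level_vec \<kappa> I) ** V) =
    sqrt ((\<Sum>i\<in>UNIV. (a $ i)\<^sup>2) + 30 * \<kappa>\<^sup>2
      - 10 * (\<Sum>k\<in>UNIV. \<kappa> * a $ k * (\<Sum>l\<in>I. (cmod ((U ** dagger V) $ k $ l))\<^sup>2)))"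
proof -
  define R where "R = U ** dagger V"
  define p where "p = level_vec \<kappa> I"
  have R: "R \<in> unitary_matrices"
    unfolding R_def by (intro unitary_mult unitary_dagger U V)
  have QQ: "Re (trace ((dagger U ** diag_mat a ** U) ** (dagger U ** diag_mat a ** U))) = (\<Sum>i\<in>UNIV. (a $ i)\<^sup>2)"
    by (simp add: unitary_conj_mult[OF U] trace_unitary_conj[OF U] diag_mat_mult trace_diag_mat power2_eq_square)
  have "Re (trace ((dagger V ** diag_mat p ** V) ** (dagger V ** diag_mat p ** V))) = (\<Sum>i\<in>UNIV. (p $ i)\<^sup>2)"
    by (simp add: unitary_conj_mult[OF V] trace_unitary_conj[OF V] diag_mat_mult trace_diag_mat power2_eq_square)
  also have "\<dots> = (\<Sum>i\<in>UNIV. 4 * \<kappa>\<^sup>2 + (if i \<in> I then 5 * \<kappa>\<^sup>2 else 0))"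
    by (intro sum.cong) (auto simp: p_def level_vec_def power_mult_distrib)
  also have "\<dots> = 30 * \<kappa>\<^sup>2"
    by (simp add: sum.distrib sum.If_cases I)
  finally have PP: "Re (trace ((dagger V ** diag_mat p ** V) ** (dagger V ** diag_mat p ** V))) = 30 * \<kappa>\<^sup>2" .
  have "trace ((dagger U ** diag_mat a ** U) ** (dagger V ** diag_mat p ** V))
      = trace (dagger U ** (diag_mat a ** (U ** dagger V) ** diag_mat p ** V))"
    by (simp only: matrix_mul_assoc)
  also have "\<dots> = trace (diag_mat a ** (R ** diag_mat p ** dagger R))"
    by (subst trace_mul_sym) (simp add: R_def dagger_mult matrix_mul_assoc)
  finally have "Re (trace ((dagger U ** diag_mat a ** U) ** (dagger V ** diag_mat p ** V)))
      = (\<Sum>k\<in>UNIV. a $ k * (\<Sum>l\<in>UNIV. p $ l * (cmod (R $ k $ l))\<^sup>2))"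
    by (simp add: trace_diag_conj)
  also have "\<dots> = (\<Sum>k\<in>UNIV. 5 * (\<kappa> * a $ k * (\<Sum>l\<in>I. (cmod (R $ k $ l))\<^sup>2)) - 2 * \<kappa> * a $ k)"
  proof (intro sum.cong refl)
    fix k
    have "(\<Sum>l\<in>UNIV. p $ l * (cmod (R $ k $ l))\<^sup>2)
      = (\<Sum>l\<in>UNIV. 5 * \<kappa> * (if l \<in> I then (cmod (R $ k $ l))\<^sup>2 else 0) - 2 * \<kappa> * (cmod (R $ k $ l))\<^sup>2)"
      by (intro sum.cong) (auto simp: p_def level_vec_def algebra_simps)
    also have "\<dots> = 5 * \<kappa> * (\<Sum>l\<in>I. (cmod (R $ k $ l))\<^sup>2) - 2 * \<kappa>"
      by (simp add: sum_subtractf unitary_row_sum[OF R] sum.If_cases flip: sum_distrib_left)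
    finally have p: "(\<Sum>l\<in>UNIV. p $ l * (cmod (R $ k $ l))\<^sup>2) = 5 * \<kappa> * (\<Sum>l\<in>I. (cmod (R $ k $ l))\<^sup>2) - 2 * \<kappa>" .
    show "a $ k * (\<Sum>l\<in>UNIV. p $ l * (cmod (R $ k $ l))\<^sup>2)
      = 5 * (\<kappa> * a $ k * (\<Sum>l\<in>I. (cmod (R $ k $ l))\<^sup>2)) - 2 * \<kappa> * a $ k"
      unfolding p by (simp add: algebra_simps)
  qed
  also have "\<dots> = 5 * (\<Sum>k\<in>UNIV. \<kappa> * a $ k * (\<Sum>l\<in>I. (cmod (R $ k $ l))\<^sup>2))"
    using a by (simp add: sum_subtractf flip: sum_distrib_left)
  finally show ?thesis
    unfolding frob_def frob_square_diff p_def[symmetric] R_def[symmetric] QQ PP by simp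
qed

lemma frob_diff_level_same:
  fixes a :: "real^5"
  assumes U: "U \<in> unitary_matrices" and I: "card I = 2" and a: "(\<Sum>i\<in>UNIV. a $ i) = 0"
  shows "frob (dagger U ** diag_mat a ** U - dagger U ** diag_mat (level_vec \<kappa> I) ** U) =
    sqrt ((\<Sum>i\<in>UNIV. (a $ i)\<^sup>2) + 30 * \<kappa>\<^sup>2 - 10 * (\<Sum>k\<in>I. \<kappa> * a $ k))"
proof -
  have "(\<Sum>l\<in>I. (cmod ((U ** dagger U) $ k $ l))\<^sup>2) = (if k \<in> I then 1 else 0)" for k
    using U by (simp add: unitary_matrices_def mat_def if_distrib[where f="\<lambda>x. (cmod x)\<^sup>2"] cong: if_cong)
  then have "(\<Sum>k\<in>UNIV. \<kappa> * a $ k * (\<Sum>l\<in>I. (cmod ((U ** dagger U) $ k $ l))\<^sup>2)) = (\<Sum>k\<in>I. \<kappa> * a $ k)"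
    by (simp add: if_distrib[where f="\<lambda>x. _ * x"] sum.If_cases cong: if_cong)
  then show ?thesis
    by (simp add: frob_diff_level[OF U U I a])
qed

lemma frob_diff_level_ge:
  fixes a :: "real^5"
  assumes U: "U \<in> unitary_matrices" and P: "P \<in> orbit (diag_mat (level_vec \<kappa> I))" and I: "card I = 2"
    and a: "(\<Sum>i\<in>UNIV. a $ i) = 0"
    and \<alpha>: "\<And>k. k \<in> I \<Longrightarrow> \<alpha> \<le> \<kappa> * a $ k" "\<And>k. k \<notin> I \<Longrightarrow> \<kappa> * a $ k \<le> \<alpha>"
  shows "sqrt ((\<Sum>i\<in>UNIV. (a $ i)\<^sup>2) + 30 * \<kappa>\<^sup>2 - 10 * (\<Sum>k\<in>I. \<kappa> * a $ k))
    \<le> frob (dagger U ** diag_mat a ** U - P)"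
proof -
  obtain V where V: "V \<in> unitary_matrices" "P = dagger V ** diag_mat (level_vec \<kappa> I) ** V"
    using P special_unitary_subset_unitary by (auto simp: orbit_def)
  have "U ** dagger V \<in> unitary_matrices"
    by (intro unitary_mult unitary_dagger U V)
  from unitary_rearrangement[OF this, of I \<alpha> "\<lambda>k. \<kappa> * a $ k"] \<alpha> show ?thesis
    unfolding V(2) frob_diff_level[OF U V(1) I a] by simp
qed

text \<open>The bound from rearrangement is attained at the orbit point conjugated by the same U.
  The threshold \<alpha> puts the two top eigenvalues on I if \<kappa> > 0 and the two bottom ones
  if \<kappa> < 0.\<close>

lemma frob_dist_level:
  fixes a :: "real^5"
  assumes U: "U \<in> special_unitary" and I: "card I = 2" and a: "(\<Sum>i\<in>UNIV. a $ i) = 0"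
    and \<alpha>: "\<And>k. k \<in> I \<Longrightarrow> \<alpha> \<le> \<kappa> * a $ k" "\<And>k. k \<notin> I \<Longrightarrow> \<kappa> * a $ k \<le> \<alpha>"
  shows "frob_dist (dagger U ** diag_mat a ** U) (orbit (diag_mat (level_vec \<kappa> I))) =
    sqrt ((\<Sum>i\<in>UNIV. (a $ i)\<^sup>2) + 30 * \<kappa>\<^sup>2 - 10 * (\<Sum>k\<in>I. \<kappa> * a $ k))"
proof -
  have U': "U \<in> unitary_matrices"
    using U special_unitary_subset_unitary by blast
  have P: "dagger U ** diag_mat (level_vec \<kappa> I) ** U \<in> orbit (diag_mat (level_vec \<kappa> I))"
    using U by (auto simp: orbit_def)
  show ?thesis
    unfolding frob_dist_def
  proof (rule cInf_eq_minimum)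
    show "sqrt ((\<Sum>i\<in>UNIV. (a $ i)\<^sup>2) + 30 * \<kappa>\<^sup>2 - 10 * (\<Sum>k\<in>I. \<kappa> * a $ k))
        \<in> (\<lambda>P. frob (dagger U ** diag_mat a ** U - P)) ` orbit (diag_mat (level_vec \<kappa> I))"
      using P unfolding frob_diff_level_same[OF U' I a, symmetric] by (rule imageI)
  qed (use frob_diff_level_ge[OF U' _ I a \<alpha>] in auto)
qed

section \<open>The two vacua and the distance of their orbits\<close>

lemma UNIV_5: "(UNIV :: 5 set) = {1, 2, 3, 4, 5}"
proof -
  have "x = 1 \<or> x = 2 \<or> x = 3 \<or> x = 4 \<or> x = 5" for x :: 5
  proof (induct x)
    case (of_int z)
    then have "z = 0 \<or> z = 1 \<or> z = 2 \<or> z = 3 \<or> z = 4" by fastforce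
    then show ?case by auto
  qed
  then show ?thesis by blast
qed

lemma sum_5: "sum f (UNIV :: 5 set) = f 1 + f 2 + f 3 + f 4 + f 5" for f :: "5 \<Rightarrow> 'a::comm_monoid_add"
  unfolding UNIV_5 by (simp add: ac_simps)

lemma vac_plus_eq: "vac_plus \<mu> lam = diag_mat (level_vec (vac_scale \<mu> lam) {1, 2})"
proof -
  have "\<forall>i\<in>UNIV. (vac_scale \<mu> lam *\<^sub>R vector [3, 3, -2, -2, -2] :: real^5) $ i = level_vec (vac_scale \<mu> lam) {1, 2} $ i"
    unfolding UNIV_5 by (simp add: level_vec_def vector_5)
  then have "level_vec (vac_scale \<mu> lam) {1, 2} = vac_scale \<mu> lam *\<^sub>R vector [3, 3, -2, -2, -2]"
    by (simp add: vec_eq_iff)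
  then show ?thesis
    by (simp add: vac_plus_def vec_eq_iff diag_mat_def scaleR_conv_of_real[where 'a=complex])
qed

lemma vac_minus_eq: "vac_minus \<mu> lam = diag_mat (level_vec (- vac_scale \<mu> lam) {3, 4})"
proof -
  have "\<forall>i\<in>UNIV. (vac_scale \<mu> lam *\<^sub>R vector [2, 2, -3, -3, 2] :: real^5) $ i = level_vec (- vac_scale \<mu> lam) {3, 4} $ i"
    unfolding UNIV_5 by (simp add: level_vec_def vector_5)
  then have "level_vec (- vac_scale \<mu> lam) {3, 4} = vac_scale \<mu> lam *\<^sub>R vector [2, 2, -3, -3, 2]"
    by (simp add: vec_eq_iff)
  then show ?thesis
    by (simp add: vac_minus_def vec_eq_iff diag_mat_def scaleR_conv_of_real[where 'a=complex])
qed

lemma mat_1_special_unitary: "mat 1 \<in> special_unitary"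
  by (simp add: special_unitary_def)

lemma mat_1_unitary: "mat 1 \<in> unitary_matrices"
  by (simp add: unitary_matrices_def)

lemma self_in_orbit: "P \<in> orbit P"
proof -
  have "P = dagger (mat 1) ** P ** mat 1" by simp
  then show ?thesis
    unfolding orbit_def using mat_1_special_unitary by blast
qed

text \<open>The diagonal vacua already realize the minimum: u times the minus vacuum is 2 u^2 at 1,
  2, 5 and -3 u^2 at 3, 4, so {1, 2} carries two top entries, with a tie at 5.\<close>

lemma vac_dist_eq:
  assumes "vac_scale \<mu> lam \<ge> 0"
  shows "vac_dist \<mu> lam = 2 * sqrt 5 * vac_scale \<mu> lam"
proof -
  define u where "u = vac_scale \<mu> lam"
  define a where "a = level_vec (- u) {3, 4}"
  have a: "(\<Sum>i\<in>UNIV. a $ i) = 0" "(\<Sum>i\<in>UNIV. (a $ i)\<^sup>2) = 30 * u\<^sup>2" "(\<Sum>i\<in>{1, 2}. u * a $ i) = 4 * u\<^sup>2"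
    by (simp_all add: a_def level_vec_def sum_5 power2_eq_square)
  have bound: "2 * u\<^sup>2 \<le> u * a $ k" if "k \<in> {1, 2}" for k
    using that by (auto simp: a_def level_vec_def power2_eq_square)
  have bound': "u * a $ k \<le> 2 * u\<^sup>2" for k
    by (simp add: a_def level_vec_def power2_eq_square)
  have card: "card {1, 2 :: 5} = 2" by simp
  have "sqrt (30 * u\<^sup>2 + 30 * u\<^sup>2 - 10 * (4 * u\<^sup>2)) = sqrt ((2 * sqrt 5 * u)\<^sup>2)"
    by (simp add: power_mult_distrib)
  also have "\<dots> = 2 * sqrt 5 * u"
    using assms unfolding real_sqrt_abs u_def by simp
  finally have d: "sqrt (30 * u\<^sup>2 + 30 * u\<^sup>2 - 10 * (4 * u\<^sup>2)) = 2 * sqrt 5 * u" .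
  show ?thesis
    unfolding vac_dist_def frob_setdist_def vac_plus_eq vac_minus_eq u_def[symmetric] a_def[symmetric]
  proof (rule cInf_eq_minimum)
    have "frob (diag_mat a - diag_mat (level_vec u {1, 2})) = 2 * sqrt 5 * u"
      using frob_diff_level_same[OF mat_1_unitary card a(1), of u] unfolding a d by simp
    then show "2 * sqrt 5 * u \<in> (\<lambda>(P, Q). frob (P - Q)) ` (orbit (diag_mat a) \<times> orbit (diag_mat (level_vec u {1, 2})))"
      using self_in_orbit by force
  next
    fix x
    assume "x \<in> (\<lambda>(P, Q). frob (P - Q)) ` (orbit (diag_mat a) \<times> orbit (diag_mat (level_vec u {1, 2})))"
    then obtain U P where U: "U \<in> special_unitary" and P: "P \<in> orbit (diag_mat (level_vec u {1, 2}))"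
      and x: "x = frob (dagger U ** diag_mat a ** U - P)"
      by (auto simp: orbit_def)
    have "U \<in> unitary_matrices" using U special_unitary_subset_unitary by blast
    from frob_diff_level_ge[OF this P card a(1) bound bound'] show "2 * sqrt 5 * u \<le> x"
      unfolding x a d .
  qed
qed

lemma hermitian_diagonalization_grouped:
  fixes Q :: "complex^'n^'n"
  assumes Q: "dagger Q = Q" and \<kappa>: "\<kappa> \<noteq> 0"
  obtains U a where "U \<in> special_unitary" "Q = dagger U ** diag_mat a ** U"
    "\<And>k l. k \<in> I \<Longrightarrow> l \<notin> I \<Longrightarrow> \<kappa> * a $ l \<le> \<kappa> * a $ k"
proof -
  obtain N and f :: "'n \<Rightarrow> nat" where f: "f ` UNIV = {i. i < N}" "inj f"
    using finite_imp_inj_to_nat_seg[OF finite_class.finite_UNIV] by metis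
  have fN: "f k < N" for k using f(1) by auto
  \<comment> \<open>Adding N moves the entries of I above all others, and the sign of \<kappa>
    reverses the order when \<kappa> is negative.\<close>
  define b :: "real^'n" where "b = (\<chi> k. sgn \<kappa> * real (f k + (if k \<in> I then N else 0)))"
  have "f i + (if i \<in> I then N else 0) \<noteq> f j + (if j \<in> I then N else 0)" if "i \<noteq> j" for i j
    using fN[of i] fN[of j] injD[OF f(2), of i j] that by auto
  then have "b $ i \<noteq> b $ j" if "i \<noteq> j" for i j
    using that \<kappa> by (simp add: b_def sgn_0_0 del: of_nat_add)
  then obtain U a where U: "U \<in> special_unitary" "Q = dagger U ** diag_mat a ** U"
    and a: "\<And>i j. b $ j \<le> b $ i \<Longrightarrow> a $ j \<le> a $ i"
    using hermitian_diagonalization[OF Q, of b] by metis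
  have "\<kappa> * a $ l \<le> \<kappa> * a $ k" if kl: "k \<in> I" "l \<notin> I" for k l
  proof -
    consider "\<kappa> > 0" | "\<kappa> < 0" using \<kappa> by linarith
    then show ?thesis
    proof cases
      case 1
      then have "b $ l \<le> b $ k" using fN[of l] kl by (simp add: b_def)
      then show ?thesis using a 1 by simp
    next
      case 2
      then have "b $ k \<le> b $ l" using fN[of l] kl by (simp add: b_def)
      then show ?thesis using a 2 by simp
    qed
  qed
  with U show thesis by (rule that)
qed

section \<open>The potential in units of the vacuum scale\<close>

lemma potential_rescaled:
  fixes a :: "real^'n"
  assumes lam: "lam > 0" and u: "u\<^sup>2 = \<mu>\<^sup>2 / (5 * lam)"
    and h: "h = - (3 / 20) * lam" and V\<^sub>0: "V\<^sub>0 = 3 * \<mu> ^ 4 / lam"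
    and U: "U \<in> unitary_matrices"
    and t: "(\<Sum>i\<in>UNIV. (a $ i)\<^sup>2) = u\<^sup>2 * t" and q: "(\<Sum>i\<in>UNIV. (a $ i) ^ 4) = u ^ 4 * q"
  shows "potential \<mu> h lam V\<^sub>0 (dagger U ** diag_mat a ** U)
    = lam * u ^ 4 * (75 - 5 * t - 3/20 * t\<^sup>2 + q)"
proof -
  have \<mu>2: "\<mu>\<^sup>2 = 5 * lam * u\<^sup>2" using u lam by simp
  have "\<mu> ^ 4 = (5 * lam * u\<^sup>2)\<^sup>2" unfolding \<mu>2[symmetric] by simp
  then have V: "V\<^sub>0 = 75 * lam * u ^ 4"
    unfolding V\<^sub>0 using lam by (simp add: power2_eq_square power4_eq_xxxx)
  show ?thesis
    unfolding potential_unitary_conj[OF U] t q V h \<mu>2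
    by (simp add: algebra_simps power2_eq_square power4_eq_xxxx)
qed

text \<open>Dividing the eigenvalues by \<kappa> = u or -u carries either vacuum to the pattern (3,
  3, -2, -2, -2), with 3 at i and j. As W is even, the sign of \<kappa> disappears, and the bounds
  for five reals apply to both orbits.\<close>

lemma potential_ge_near_orbit:
  fixes Q :: "complex^5^5"
  assumes lam: "lam > 0" and u: "u > 0" "u\<^sup>2 = \<mu>\<^sup>2 / (5 * lam)" "\<kappa>\<^sup>2 = u\<^sup>2"
    and h: "h = - (3 / 20) * lam" and V\<^sub>0: "V\<^sub>0 = 3 * \<mu> ^ 4 / lam"
    and Q: "Q \<in> hermitian_traceless"
    and enum: "(UNIV :: 5 set) = {i, j, k, l, m}" "distinct [i, j, k, l, m]"
  defines "\<delta> \<equiv> frob_dist Q (orbit (diag_mat (level_vec \<kappa> {i, j})))"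
  defines "s \<equiv> \<delta> / (2 * sqrt 5 * u)"
  shows "0 \<le> potential \<mu> h lam V\<^sub>0 Q"
    and "s \<le> 1/2 \<Longrightarrow> 200 * lam * u ^ 4 * s\<^sup>2 * (1 - s)\<^sup>2 \<le> potential \<mu> h lam V\<^sub>0 Q"
proof -
  have card: "card {i, j} = 2" using enum(2) by simp
  have sum: "(\<Sum>r\<in>UNIV. f r) = f i + f j + f k + f l + f m" for f :: "5 \<Rightarrow> real"
    unfolding enum(1) using enum(2) by simp
  have herm: "dagger Q = Q" and tr: "trace Q = 0"
    using Q by (auto simp: hermitian_traceless_def)
  have \<kappa>: "\<kappa> \<noteq> 0" using u by auto
  obtain U a where U: "U \<in> special_unitary" and QU: "Q = dagger U ** diag_mat a ** U"
    and a: "\<And>r t. r \<in> {i, j} \<Longrightarrow> t \<notin> {i, j} \<Longrightarrow> \<kappa> * a $ t \<le> \<kappa> * a $ r"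
    using hermitian_diagonalization_grouped[OF herm \<kappa>, of "{i, j}"] by metis
  have U': "U \<in> unitary_matrices" using U special_unitary_subset_unitary by blast
  have a0: "(\<Sum>r\<in>UNIV. a $ r) = 0"
    using tr unfolding QU trace_unitary_conj[OF U'] trace_diag_mat by (simp flip: of_real_sum)
  define x where "x r = a $ r / \<kappa>" for r
  have ax: "a $ r = \<kappa> * x r" for r using \<kappa> by (simp add: x_def)
  have x0: "x i + x j + x k + x l + x m = 0"
    using a0 \<kappa> unfolding sum ax by (simp flip: distrib_left)
  define t q where "t = (x i)\<^sup>2 + (x j)\<^sup>2 + (x k)\<^sup>2 + (x l)\<^sup>2 + (x m)\<^sup>2"
    and "q = (x i) ^ 4 + (x j) ^ 4 + (x k) ^ 4 + (x l) ^ 4 + (x m) ^ 4"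
  have k4: "\<kappa> ^ 4 = u ^ 4"
    using arg_cong[OF u(3), of "\<lambda>z. z\<^sup>2"] by simp
  have ts: "(\<Sum>r\<in>UNIV. (a $ r)\<^sup>2) = u\<^sup>2 * t" "(\<Sum>r\<in>UNIV. (a $ r) ^ 4) = u ^ 4 * q"
    unfolding sum ax t_def q_def power_mult_distrib u(3) k4 by (simp_all add: algebra_simps)
  have pot: "potential \<mu> h lam V\<^sub>0 Q = lam * u ^ 4 * (75 - 5 * t - 3/20 * t\<^sup>2 + q)"
    unfolding QU by (rule potential_rescaled[OF lam u(2) h V\<^sub>0 U' ts])
  have c: "0 \<le> lam * u ^ 4" using lam u by simp
  show "0 \<le> potential \<mu> h lam V\<^sub>0 Q"
    unfolding pot using quartic_nonneg[OF x0] c by (simp add: t_def q_def)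
  have \<delta>: "\<delta> = sqrt ((\<Sum>r\<in>UNIV. (a $ r)\<^sup>2) + 30 * \<kappa>\<^sup>2 - 10 * (\<Sum>r\<in>{i, j}. \<kappa> * a $ r))"
    unfolding \<delta>_def QU
  proof (rule frob_dist_level[OF U card a0, of "min (\<kappa> * a $ i) (\<kappa> * a $ j)"])
  qed (use a in auto)
  have D: "(\<Sum>r\<in>UNIV. (a $ r)\<^sup>2) + 30 * \<kappa>\<^sup>2 - 10 * (\<Sum>r\<in>{i, j}. \<kappa> * a $ r) = u\<^sup>2 * (t + 30 - 10 * (x i + x j))"
  proof -
    have "(\<Sum>r\<in>{i, j}. \<kappa> * a $ r) = \<kappa>\<^sup>2 * (x i + x j)"
      using enum(2) by (simp add: ax power2_eq_square algebra_simps)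
    then show ?thesis unfolding ts u(3) by (simp add: algebra_simps)
  qed
  \<comment> \<open>The squared distance to the pattern; its nonnegativity allows the square root in
    \<delta> to be squared away.\<close>
  have "0 \<le> (x i - 3)\<^sup>2 + (x j - 3)\<^sup>2 + (x k + 2)\<^sup>2 + (x l + 2)\<^sup>2 + (x m + 2)\<^sup>2"
    by simp
  also have "\<dots> = t + 30 - 10 * (x i + x j) + 4 * (x i + x j + x k + x l + x m)"
    unfolding t_def by (simp add: power2_eq_square algebra_simps)
  finally have D0: "0 \<le> t + 30 - 10 * (x i + x j)"
    unfolding x0 by simp
  have \<delta>2: "\<delta> \<ge> 0" "\<delta>\<^sup>2 = u\<^sup>2 * (t + 30 - 10 * (x i + x j))"
    unfolding \<delta> D using D0 by simp_all
  have s: "0 \<le> s" unfolding s_def using \<delta>2 u by simp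
  have s2: "t + 30 - 10 * (x i + x j) = 20 * s\<^sup>2"
    unfolding s_def power_divide power_mult_distrib \<delta>2 using u(1) by simp
  assume "s \<le> 1/2"
  from well_bound[OF x0 s this] s2
  have "200 * s\<^sup>2 * (1 - s)\<^sup>2 \<le> 75 - 5 * t - 3/20 * t\<^sup>2 + q"
    by (simp add: t_def q_def)
  from mult_left_mono[OF this c] show "200 * lam * u ^ 4 * s\<^sup>2 * (1 - s)\<^sup>2 \<le> potential \<mu> h lam V\<^sub>0 Q"
    unfolding pot by (simp add: mult_ac)
qed

text \<open>On the segment the eigenvalues are u times (3-s, 3-s, -2-s, -2-s, 4s-2). The second
  formula is the first at 1 - s, since the result is symmetric.\<close>

lemma potential_interpolation:
  assumes lam: "lam > 0" and u: "u = vac_scale \<mu> lam" "u\<^sup>2 = \<mu>\<^sup>2 / (5 * lam)"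
    and h: "h = - (3 / 20) * lam" and V\<^sub>0: "V\<^sub>0 = 3 * \<mu> ^ 4 / lam"
  shows "potential \<mu> h lam V\<^sub>0 (s *\<^sub>R vac_minus \<mu> lam + (1 - s) *\<^sub>R vac_plus \<mu> lam)
      = 200 * lam * u ^ 4 * s\<^sup>2 * (1 - s)\<^sup>2"
    and "potential \<mu> h lam V\<^sub>0 (s *\<^sub>R vac_plus \<mu> lam + (1 - s) *\<^sub>R vac_minus \<mu> lam)
      = 200 * lam * u ^ 4 * s\<^sup>2 * (1 - s)\<^sup>2"
proof -
  have *: "potential \<mu> h lam V\<^sub>0 (s *\<^sub>R vac_minus \<mu> lam + (1 - s) *\<^sub>R vac_plus \<mu> lam)
      = 200 * lam * u ^ 4 * s\<^sup>2 * (1 - s)\<^sup>2" for s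
  proof -
    define a where "a = s *\<^sub>R level_vec (- u) {3, 4} + (1 - s) *\<^sub>R level_vec u {1, 2}"
    have Q: "s *\<^sub>R vac_minus \<mu> lam + (1 - s) *\<^sub>R vac_plus \<mu> lam = dagger (mat 1) ** diag_mat a ** mat 1"
      unfolding vac_plus_eq vac_minus_eq u(1)[symmetric]
      by (simp add: vec_eq_iff a_def diag_mat_def scaleR_conv_of_real[where 'a=complex])
    have a: "a $ 1 = u * (3 - s)" "a $ 2 = u * (3 - s)" "a $ 3 = u * (- 2 - s)" "a $ 4 = u * (- 2 - s)"
      "a $ 5 = u * (4 * s - 2)"
      by (simp_all add: a_def level_vec_def algebra_simps)
    define t q where "t = 2 * (3 - s)\<^sup>2 + 2 * (- 2 - s)\<^sup>2 + (4 * s - 2)\<^sup>2"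
      and "q = 2 * (3 - s) ^ 4 + 2 * (- 2 - s) ^ 4 + (4 * s - 2) ^ 4"
    have S: "(\<Sum>i\<in>UNIV. (a $ i)\<^sup>2) = u\<^sup>2 * t" "(\<Sum>i\<in>UNIV. (a $ i) ^ 4) = u ^ 4 * q"
      unfolding sum_5 a power_mult_distrib t_def q_def by (simp_all only: distrib_left mult_2 add_ac)
    have "75 - 5 * t - 3/20 * t\<^sup>2 + q = 200 * s\<^sup>2 * (1 - s)\<^sup>2"
      unfolding t_def q_def by algebra
    then show ?thesis
      unfolding Q potential_rescaled[OF lam u(2) h V\<^sub>0 mat_1_unitary S] by simp
  qed
  show "potential \<mu> h lam V\<^sub>0 (s *\<^sub>R vac_minus \<mu> lam + (1 - s) *\<^sub>R vac_plus \<mu> lam)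
      = 200 * lam * u ^ 4 * s\<^sup>2 * (1 - s)\<^sup>2"
    by (rule *)
  show "potential \<mu> h lam V\<^sub>0 (s *\<^sub>R vac_plus \<mu> lam + (1 - s) *\<^sub>R vac_minus \<mu> lam)
      = 200 * lam * u ^ 4 * s\<^sup>2 * (1 - s)\<^sup>2"
    using *[of "1 - s"] by (simp add: add.commute mult_ac)
qed

theorem proposition9:
  fixes \<mu> lam h V\<^sub>0 :: real
    and Q :: "complex^5^5"
  assumes "\<mu> > 0" and "lam > 0"
    and "h = - (3 / 20) * lam"
    and "V\<^sub>0 = 3 * \<mu> ^ 4 / lam"
    and "Q \<in> hermitian_traceless"
  shows "potential \<mu> h lam V\<^sub>0 Q \<ge> lower_potential \<mu> h lam V\<^sub>0 Q"
proof -
  define u where "u = vac_scale \<mu> lam"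
  define d where "d = vac_dist \<mu> lam"
  have u: "u > 0" "u\<^sup>2 = \<mu>\<^sup>2 / (5 * lam)"
    using assms(1,2) by (simp_all add: u_def vac_scale_def power_divide power_mult_distrib)
  have d: "d = 2 * sqrt 5 * u"
    using vac_dist_eq u(1) by (simp add: d_def u_def)
  have d0: "d > 0" using u(1) by (simp add: d)
  have half: "\<delta> / d \<le> 1 / 2" if "\<delta> < d / 2" for \<delta>
    using that d0 by (simp add: field_simps)
  note near = potential_ge_near_orbit[OF assms(2) u _ assms(3-5)]
  have plus: "0 \<le> potential \<mu> h lam V\<^sub>0 Q"
    "frob_dist Q (orbit (vac_plus \<mu> lam)) / d \<le> 1 / 2 \<Longrightarrow>
      200 * lam * u ^ 4 * (frob_dist Q (orbit (vac_plus \<mu> lam)) / d)\<^sup>2 * (1 - frob_dist Q (orbit (vac_plus \<mu> lam)) / d)\<^sup>2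
      \<le> potential \<mu> h lam V\<^sub>0 Q"
    \<comment> \<open>The plus orbit takes \<kappa> = u and the indices 1, 2; the minus orbit below
      takes \<kappa> = -u and 3, 4.\<close>
    using near[of u 1 2 3 4 5] UNIV_5 by (simp_all add: vac_plus_eq u_def d)
  have minus: "frob_dist Q (orbit (vac_minus \<mu> lam)) / d \<le> 1 / 2 \<Longrightarrow>
      200 * lam * u ^ 4 * (frob_dist Q (orbit (vac_minus \<mu> lam)) / d)\<^sup>2 * (1 - frob_dist Q (orbit (vac_minus \<mu> lam)) / d)\<^sup>2
      \<le> potential \<mu> h lam V\<^sub>0 Q"
    using near(2)[of "- u" 3 4 1 2 5] UNIV_5 by (simp add: vac_minus_eq u_def d insert_commute)
  show ?thesis
    unfolding lower_potential_def Let_def d_def[symmetric] 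
      potential_interpolation[OF assms(2) u_def u(2) assms(3,4)]
    using plus minus half by simp
qed

end
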